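(* Let $n=5$ and let $\boldsymbol v^0$ be the quintuple-periodic field of the context at either of the phase vectors $$\boldsymbol\xi^{*}=\left(-\tfrac{\pi}{4},\tfrac{\pi}{4},\tfrac{\pi}{4},\tfrac{\pi}{4},\tfrac{\pi}{4}\right)\quad\text{or}\quad\boldsymbol\xi^{**}=\left(0,\tfrac{\pi}{2},\pi,\pi,\pi\right),$$ and let $\boldsymbol g^0=(\boldsymbol v^0\cdot\nabla)\boldsymbol v^0$. Then (i) $\boldsymbol v^0\not\equiv\boldsymbol 0$ and $\nabla\cdot\boldsymbol v^0=0$; (ii) $\nabla\cdot\boldsymbol g^0=0$ identically, so the longitudinal part of $\boldsymbol g^0$ vanishes and $\boldsymbol g^0$ is purely transverse; (iii) $\boldsymbol g^0$ is not a gradient: $\partial_jg_i^0-\partial_ig_j^0\not\equiv0$ for some $i,j$; (iv) consequently the pressure carries no spatial dependence, $p=p(t)$ (every spatially periodic solution of $\Delta p=-\rho\,\nabla\cdot\boldsymbol g^0$ is constant in $\boldsymbol x$). Define the body-force amplitude $\boldsymbol f^0=\boldsymbol g^0=\nabla\cdot(\boldsymbol v^0\otimes\boldsymbol v^0)$, which has zero mean over a periodic cell. Then the velocity $\boldsymbol v(\boldsymbol x,t)=\boldsymbol v^0(\boldsymbol x)e^{-5\alpha^2\kappa t}$ together with any pressure $p(\boldsymbol x,t)=p(t)$, $\nabla p=\boldsymbol0$, is an exact solution of the incompressible Navier--Stokes equations on $\mathbb R^5$, $t\ge0$, under the body force $\boldsymbol f(\boldsymbol x,t)=\boldsymbol f^0(\boldsymbol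 x)e^{-10\alpha^2\kappa t}$.
   Context: Fix $\alpha>0$, $v_r>0$, density $\rho>0$, viscosity $\kappa>0$. The first component of the field is $$\frac{v_1^0}{v_r}=\sin(\alpha x_1+\xi_1)\cos(\alpha x_2+\xi_2)\sin(\alpha x_3+\xi_3)\cos(\alpha x_4+\xi_4)\sin(\alpha x_5+\xi_5)-\sin(\alpha x_1+\xi_2)\sin(\alpha x_2+\xi_3)\cos(\alpha x_3+\xi_4)\sin(\alpha x_4+\xi_5)\cos(\alpha x_5+\xi_1),$$ and $v_i^0$ is obtained from $v_1^0$ by the cyclic coordinate permutation $x_j\mapsto x_{i+j-1}$ (indices modulo 5, in $\{1,\dots,5\}$) with the same $\boldsymbol\xi$. Here $(\nabla\cdot(\boldsymbol v\otimes\boldsymbol v))_i=\sum_j\partial_j(v_iv_j)$. The Helmholtz decomposition of a smooth periodic field is $\boldsymbol w=\nabla\phi+\boldsymbol h$, $\nabla\cdot\boldsymbol h=0$, $\Delta\phi=\nabla\cdot\boldsymbol w$; $\nabla\phi$ is the longitudinal and $\boldsymbol h$ the transverse part. The incompressible Navier--Stokes equations are $\partial_t v_i+\sum_jv_j\partial_jv_i=\kappa\Delta v_i-\rho^{-1}\partial_ip+f_i$ for all $i$, and $\nabla\cdot\boldsymbol v=0$. *)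

theory Defs
  imports "HOL-Analysis.Analysis"
begin

subsection \<open>Differential operators\<close>

definition partial :: "'n::finite \<Rightarrow> (real^'n \<Rightarrow> real) \<Rightarrow> real^'n \<Rightarrow> real" where
  "partial j f x = deriv (\<lambda>h. f (x + h *\<^sub>R axis j 1)) 0"

fun iter_partial :: "'n::finite list \<Rightarrow> (real^'n \<Rightarrow> real) \<Rightarrow> real^'n \<Rightarrow> real" where
  "iter_partial [] f = f"
| "iter_partial (j # js) f = partial j (iter_partial js f)"

text \<open>Since \<^const>\<open>deriv\<close> is total, existence of the derivatives has to be demanded
  separately: \<open>Ck k f\<close> says that \<open>f\<close> is of class \<open>C^k\<close> on the whole space.\<close>

definition Ck :: "nat \<Rightarrow> (real^'n::finite \<Rightarrow> real) \<Rightarrow> bool" where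
  "Ck k f \<longleftrightarrow>
     (\<forall>js. length js < k \<longrightarrow> (\<forall>x. iter_partial js f differentiable (at x))) \<and>
     (\<forall>js. length js \<le> k \<longrightarrow> continuous_on UNIV (iter_partial js f))"

definition smooth_fun :: "(real^'n::finite \<Rightarrow> real) \<Rightarrow> bool" where
  "smooth_fun f \<longleftrightarrow> (\<forall>k. Ck k f)"

definition smooth_field :: "(real^'n::finite \<Rightarrow> real^'n) \<Rightarrow> bool" where
  "smooth_field w \<longleftrightarrow> (\<forall>i. smooth_fun (\<lambda>x. w x $ i))"

definition grad :: "(real^'n::finite \<Rightarrow> real) \<Rightarrow> real^'n \<Rightarrow> real^'n" where
  "grad f x = (\<chi> i. partial i f x)"

definition laplacian :: "(real^'n::finite \<Rightarrow> real) \<Rightarrow> real^'n \<Rightarrow> real" where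
  "laplacian f x = (\<Sum>j\<in>UNIV. partial j (partial j f) x)"

definition divergence :: "(real^'n::finite \<Rightarrow> real^'n) \<Rightarrow> real^'n \<Rightarrow> real" where
  "divergence w x = (\<Sum>j\<in>UNIV. partial j (\<lambda>y. w y $ j) x)"

text \<open>\<open>advect u w\<close> is \<open>(u \<cdot> \<nabla>) w\<close>.\<close>

definition advect ::
    "(real^'n::finite \<Rightarrow> real^'n) \<Rightarrow> (real^'n \<Rightarrow> real^'n) \<Rightarrow> real^'n \<Rightarrow> real^'n" where
  "advect u w x = (\<chi> i. \<Sum>j\<in>UNIV. u x $ j * partial j (\<lambda>y. w y $ i) x)"

definition outer :: "real^'n::finite \<Rightarrow> real^'n \<Rightarrow> real^'n^'n" where
  "outer a b = (\<chi> i j. a $ i * b $ j)"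

definition tensor_divergence ::
    "(real^'n::finite \<Rightarrow> real^'n^'n) \<Rightarrow> real^'n \<Rightarrow> real^'n" where
  "tensor_divergence T x = (\<chi> i. \<Sum>j\<in>UNIV. partial j (\<lambda>y. T y $ i $ j) x)"


subsection \<open>Periodicity and Helmholtz decomposition\<close>

text \<open>\<open>L $ j\<close> is a period in the \<open>j\<close>-th coordinate direction.\<close>

definition periodic_with :: "real^'n::finite \<Rightarrow> (real^'n \<Rightarrow> 'b) \<Rightarrow> bool" where
  "periodic_with L f \<longleftrightarrow> (\<forall>j. 0 < L $ j) \<and> (\<forall>x j. f (x + axis j (L $ j)) = f x)"

definition spatially_periodic :: "(real^'n::finite \<Rightarrow> 'b) \<Rightarrow> bool" where
  "spatially_periodic f \<longleftrightarrow> (\<exists>L. periodic_with L f)"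

definition cell_mean :: "(real^'n::finite) set \<Rightarrow> (real^'n \<Rightarrow> real^'n) \<Rightarrow> real^'n" where
  "cell_mean C w = (1 / measure lebesgue C) *\<^sub>R integral C w"

text \<open>\<open>w = \<nabla>\<phi> + h\<close> with longitudinal part \<open>\<nabla>\<phi>\<close> and transverse part \<open>h\<close>. Periodicity of
  \<open>\<phi>\<close> and \<open>h\<close> (with the periods \<open>L\<close> of \<open>w\<close>) is what makes the two parts unique.\<close>

definition helmholtz_decomposition ::
    "real^'n::finite \<Rightarrow> (real^'n \<Rightarrow> real^'n) \<Rightarrow> (real^'n \<Rightarrow> real) \<Rightarrow> (real^'n \<Rightarrow> real^'n) \<Rightarrow> bool" where
  "helmholtz_decomposition L w \<phi> h \<longleftrightarrow>
     smooth_field w \<and> smooth_fun \<phi> \<and> smooth_field h \<and>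
     periodic_with L w \<and> periodic_with L \<phi> \<and> periodic_with L h \<and>
     (\<forall>x. w x = grad \<phi> x + h x) \<and>
     (\<forall>x. divergence h x = 0) \<and>
     (\<forall>x. laplacian \<phi> x = divergence w x)"


subsection \<open>Incompressible Navier--Stokes equations\<close>

text \<open>Classical solutions on the whole space for \<open>t \<ge> 0\<close>; arguments are ordered as \<open>v x t\<close>.
  The time derivative at \<open>t = 0\<close> is one-sided. No regularity of the pressure in time is required,
  as only its spatial gradient enters.\<close>

definition navier_stokes_solution ::
    "real \<Rightarrow> real \<Rightarrow> (real^'n::finite \<Rightarrow> real \<Rightarrow> real^'n) \<Rightarrow> (real^'n \<Rightarrow> real \<Rightarrow> real) \<Rightarrow>
     (real^'n \<Rightarrow> real \<Rightarrow> real^'n) \<Rightarrow> bool" where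
  "navier_stokes_solution \<rho> \<kappa> v p f \<longleftrightarrow>
     continuous_on (UNIV \<times> {0..}) (\<lambda>(x, t). v x t) \<and>
     (\<forall>t\<ge>0. (\<forall>i. Ck 2 (\<lambda>y. v y t $ i)) \<and> Ck 1 (\<lambda>y. p y t)) \<and>
     (\<forall>x. \<forall>t\<ge>0. (\<lambda>s. v x s) differentiable (at t within {0..})) \<and>
     (\<forall>x. \<forall>t\<ge>0. \<forall>i.
        vector_derivative (\<lambda>s. v x s) (at t within {0..}) $ i
          + (\<Sum>j\<in>UNIV. v x t $ j * partial j (\<lambda>y. v y t $ i) x)
        = \<kappa> * laplacian (\<lambda>y. v y t $ i) x
          - (1 / \<rho>) * partial i (\<lambda>y. p y t) x + f x t $ i) \<and>
     (\<forall>x. \<forall>t\<ge>0. divergence (\<lambda>y. v y t) x = 0)"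


subsection \<open>The quintuple-periodic field\<close>

text \<open>The index type \<open>5\<close> is the ring of integers modulo 5, so \<open>i + j - 1\<close> is the cyclic shift
  and the index \<open>5\<close> denotes the same element as \<open>0\<close>.\<close>

definition field1 :: "real \<Rightarrow> real \<Rightarrow> real^5 \<Rightarrow> real^5 \<Rightarrow> real" where
  "field1 \<alpha> v\<^sub>r \<xi> x = v\<^sub>r *
     (sin (\<alpha> * x$1 + \<xi>$1) * cos (\<alpha> * x$2 + \<xi>$2) * sin (\<alpha> * x$3 + \<xi>$3)
        * cos (\<alpha> * x$4 + \<xi>$4) * sin (\<alpha> * x$5 + \<xi>$5)
      - sin (\<alpha> * x$1 + \<xi>$2) * sin (\<alpha> * x$2 + \<xi>$3) * cos (\<alpha> * x$3 + \<xi>$4)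
        * sin (\<alpha> * x$4 + \<xi>$5) * cos (\<alpha> * x$5 + \<xi>$1))"

definition quintuple_field :: "real \<Rightarrow> real \<Rightarrow> real^5 \<Rightarrow> real^5 \<Rightarrow> real^5" where
  "quintuple_field \<alpha> v\<^sub>r \<xi> x = (\<chi> i. field1 \<alpha> v\<^sub>r \<xi> (\<chi> j. x $ (i + j - 1)))"

definition xi_star :: "real^5" where
  "xi_star = vector [- pi/4, pi/4, pi/4, pi/4, pi/4]"

definition xi_star_star :: "real^5" where
  "xi_star_star = vector [0, pi/2, pi, pi, pi]"

end

theory Submission
  imports Defs
begin

text \<open>
  For a set \<open>T\<close> of coordinates let \<open>wave T\<close> be the product over all \<open>k\<close> of \<open>cos (\<alpha> x_k + \<beta>)\<close> for \<open>k\<close> in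
  \<open>T\<close> and of \<open>sin (\<alpha> x_k + \<beta>)\<close> for the others. Differentiation in direction \<open>j\<close> toggles the membership
  of \<open>j\<close> in \<open>T\<close>, up to the sign and the factor \<open>\<alpha>\<close>. At both phase vectors the flow has the form
  \<open>v_i = A (wave {i+3\<sigma>} + wave {i, i+2\<sigma>, i+4\<sigma>})\<close> with indices modulo 5: \<open>\<xi>**\<close> gives \<open>\<sigma> = 1\<close>,
  \<open>\<beta> = 0\<close>, \<open>A = v_r\<close>, and \<open>\<xi>*\<close> gives the mirror image \<open>\<sigma> = -1\<close>, \<open>\<beta> = \<pi>/4\<close>, \<open>A = -v_r\<close>. So one
  computation serves both.

  The diagonal derivative \<open>\<partial>_i v_i\<close> is a difference of two waves whose position sets are translates
  of each other in \<open>\<int>/5\<close>; summed over \<open>i\<close> they cancel, and \<open>v\<close> is solenoidal. For a solenoidal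
  field, \<open>\<nabla>\<cdot>((v\<cdot>\<nabla>)v)\<close> is the trace of the square of the Jacobian. That trace is a sum of products of
  two waves, and \<open>wave S * wave T = wave (S \<inter> T) * wave (S \<union> T)\<close> brings enough of them to the same
  form up to a cyclic translation for everything to cancel (\<open>jacobian_square_trace\<close>). Every wave is
  an eigenfunction of the Laplacian with eigenvalue \<open>-5\<alpha>\<^sup>2\<close>, so diffusion only multiplies \<open>v\<close> by a
  factor decaying in time, and the body force balances the convective term exactly.

  Not being a gradient is seen at a single point, where the values of all waves are 0 except for one
  (\<open>curl_advect_u_nonzero\<close>); together with the symmetry of mixed second derivatives this excludes
  any potential. The statements on the pressure and on uniqueness of the Helmholtz decomposition
  amount to the fact that a periodic harmonic function is constant
  (\<open>periodic_harmonic_constant\<close>), which is the energy identity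
  \<open>\<integral> |\<nabla>p|\<^sup>2 = - \<integral> p \<Delta>p\<close> over a period cell. It rests, as does the vanishing mean of the force, on the
  fact that a partial derivative of a periodic function integrates to zero over a cell
  (\<open>integral_partial_period_cell\<close>).
\<close>

section \<open>Partial derivatives\<close>

lemma partial_eq_derivative:
  assumes "(f has_derivative f') (at x)"
  shows "partial j f x = f' (axis j 1)"
proof -
  interpret f': bounded_linear f' using assms by (rule has_derivative_bounded_linear)
  have "((\<lambda>h. x + h *\<^sub>R axis j 1) has_derivative (\<lambda>h. h *\<^sub>R axis j 1)) (at 0)"
    by (auto intro!: derivative_eq_intros)
  moreover have "(f has_derivative f') (at (x + 0 *\<^sub>R axis j 1))"
    using assms by simp
  ultimately have "((\<lambda>h. f (x + h *\<^sub>R axis j 1)) has_derivative (\<lambda>h. f' (h *\<^sub>R axis j 1))) (at 0)"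
    using has_derivative_compose by blast
  then have "((\<lambda>h. f (x + h *\<^sub>R axis j 1)) has_field_derivative f' (axis j 1)) (at 0)"
    unfolding has_field_derivative_def
    by (rule has_derivative_eq_rhs) (simp add: f'.scaleR fun_eq_iff)
  then show ?thesis unfolding partial_def by (rule DERIV_imp_deriv)
qed

lemma partial_eq_frechet:
  "f differentiable (at x) \<Longrightarrow> partial j f x = frechet_derivative f (at x) (axis j 1)"
  by (simp add: frechet_derivative_works partial_eq_derivative)

lemma has_real_derivative_along_axis:
  assumes "f differentiable (at (x + t *\<^sub>R axis j 1))"
  shows "((\<lambda>h. f (x + h *\<^sub>R axis j 1)) has_real_derivative partial j f (x + t *\<^sub>R axis j 1)) (at t within S)"
proof -
  let ?f' = "frechet_derivative f (at (x + t *\<^sub>R axis j 1))"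
  have f': "(f has_derivative ?f') (at (x + t *\<^sub>R axis j 1))"
    using assms by (simp add: frechet_derivative_works)
  interpret f': bounded_linear ?f' using f' by (rule has_derivative_bounded_linear)
  have "((\<lambda>h. x + h *\<^sub>R axis j 1) has_derivative (\<lambda>h. h *\<^sub>R axis j 1)) (at t)"
    by (auto intro!: derivative_eq_intros)
  then have "((\<lambda>h. f (x + h *\<^sub>R axis j 1)) has_derivative (\<lambda>h. ?f' (h *\<^sub>R axis j 1))) (at t)"
    using has_derivative_compose f' by blast
  then have "((\<lambda>h. f (x + h *\<^sub>R axis j 1)) has_field_derivative ?f' (axis j 1)) (at t)"
    unfolding has_field_derivative_def
    by (rule has_derivative_eq_rhs) (simp add: f'.scaleR fun_eq_iff)
  then show ?thesis by (simp add: partial_eq_derivative[OF f'] has_field_derivative_at_within)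
qed

lemma scaleR_axis: "t *\<^sub>R axis j 1 = axis j (t::real)"
  by (simp add: vec_eq_iff axis_def)

lemma partial_const [simp]: "partial j (\<lambda>x. c) = (\<lambda>x. 0)"
  by (simp add: partial_def fun_eq_iff)

lemma partial_add:
  assumes "f differentiable (at x)" "g differentiable (at x)"
  shows "partial j (\<lambda>x. f x + g x) x = partial j f x + partial j g x"
  using has_derivative_add[OF assms[unfolded frechet_derivative_works]]
  by (simp add: partial_eq_derivative partial_eq_frechet assms)

lemma partial_mult:
  assumes "f differentiable (at x)" "g differentiable (at x)"
  shows "partial j (\<lambda>x. f x * g x) x = f x * partial j g x + partial j f x * g x"
  using has_derivative_mult[OF assms[unfolded frechet_derivative_works]]
  by (simp add: partial_eq_derivative partial_eq_frechet assms)

lemma partial_cmult: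
  "f differentiable (at x) \<Longrightarrow> partial j (\<lambda>x. c * f x) x = c * partial j f x"
  by (simp add: partial_mult)

lemma partial_sum:
  assumes "\<And>k. k \<in> K \<Longrightarrow> f k differentiable (at x)"
  shows "partial j (\<lambda>x. \<Sum>k\<in>K. f k x) x = (\<Sum>k\<in>K. partial j (f k) x)"
proof -
  have "((\<lambda>x. \<Sum>k\<in>K. f k x) has_derivative (\<lambda>h. \<Sum>k\<in>K. frechet_derivative (f k) (at x) h)) (at x)"
    using assms by (intro has_derivative_sum) (simp add: frechet_derivative_works)
  then show ?thesis by (simp add: partial_eq_derivative partial_eq_frechet assms)
qed

lemma constant_if_grad_zero:
  fixes p :: "real^'n \<Rightarrow> real"
  assumes "\<And>x. p differentiable (at x)" and "\<And>j x. partial j p x = 0"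
  shows "\<exists>c. \<forall>x. p x = c"
proof -
  have "(p has_derivative (\<lambda>h. 0)) (at x)" for x
  proof -
    have d: "(p has_derivative frechet_derivative p (at x)) (at x)"
      using assms(1) by (simp add: frechet_derivative_works)
    have "frechet_derivative p (at x) = (\<lambda>h. 0)"
    proof (rule linear_eq_stdbasis)
      show "linear (frechet_derivative p (at x))"
        using d by (rule has_derivative_linear)
      show "linear (\<lambda>h. 0::real)" by (simp add: linear_zero)
      fix b :: "real^'n" assume "b \<in> Basis"
      then obtain j where "b = axis j 1" by (auto simp: Basis_vec_def)
      then show "frechet_derivative p (at x) b = 0"
        using assms by (simp add: partial_eq_frechet[symmetric])
    qed
    then show ?thesis using d by simp
  qed
  then show ?thesis using has_derivative_zero_constant[of UNIV p] by simp
qed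

text \<open>The mean value theorem is applied twice: first in direction \<open>i\<close> to the increment of \<open>\<phi>\<close> in
  direction \<open>j\<close>, then in direction \<open>j\<close> to \<open>\<partial>_i \<phi>\<close>. The left-hand side is symmetric in \<open>i\<close> and \<open>j\<close>,
  which is why both mixed derivatives have the same limit as \<open>h\<close> shrinks.\<close>

lemma second_difference:
  fixes \<phi> :: "real^'n \<Rightarrow> real"
  assumes "\<And>x. \<phi> differentiable (at x)" and "\<And>x. partial i \<phi> differentiable (at x)" and "0 < h"
  obtains s t where "0 < s" "s < h" "0 < t" "t < h"
    and "\<phi> (x + h *\<^sub>R axis i 1 + h *\<^sub>R axis j 1) - \<phi> (x + h *\<^sub>R axis i 1) - \<phi> (x + h *\<^sub>R axis j 1) + \<phi> x
          = h * h * partial j (partial i \<phi>) (x + s *\<^sub>R axis i 1 + t *\<^sub>R axis j 1)"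
proof -
  let ?i = "axis i (1::real)" and ?j = "axis j (1::real)"
  let ?A = "\<lambda>s. \<phi> ((x + h *\<^sub>R ?j) + s *\<^sub>R ?i) - \<phi> (x + s *\<^sub>R ?i)"
  have "\<exists>s>0. s < h \<and> ?A h - ?A 0 = (h - 0) * (partial i \<phi> ((x + h *\<^sub>R ?j) + s *\<^sub>R ?i) - partial i \<phi> (x + s *\<^sub>R ?i))"
    by (rule MVT2) (auto intro!: assms(3) DERIV_diff has_real_derivative_along_axis assms(1,2))
  then obtain s where s: "0 < s" "s < h"
    "?A h - ?A 0 = h * (partial i \<phi> ((x + h *\<^sub>R ?j) + s *\<^sub>R ?i) - partial i \<phi> (x + s *\<^sub>R ?i))" by auto
  have "\<exists>t>0. t < h \<and> partial i \<phi> ((x + s *\<^sub>R ?i) + h *\<^sub>R ?j) - partial i \<phi> ((x + s *\<^sub>R ?i) + 0 *\<^sub>R ?j)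
      = (h - 0) * partial j (partial i \<phi>) ((x + s *\<^sub>R ?i) + t *\<^sub>R ?j)"
    by (rule MVT2) (auto intro!: assms(3) has_real_derivative_along_axis assms(1,2))
  then obtain t where t: "0 < t" "t < h"
    "partial i \<phi> ((x + s *\<^sub>R ?i) + h *\<^sub>R ?j) - partial i \<phi> (x + s *\<^sub>R ?i)
      = h * partial j (partial i \<phi>) ((x + s *\<^sub>R ?i) + t *\<^sub>R ?j)" by auto
  show thesis
    using s t by (intro that[of s t]) (auto simp: algebra_simps)
qed

text \<open>Clairaut's theorem: the second difference over ever smaller squares at \<open>x\<close> is evaluated in both orders.\<close>

lemma mixed_partials_commute:
  fixes \<phi> :: "real^'n \<Rightarrow> real"
  assumes d: "\<And>x. \<phi> differentiable (at x)"
    and di: "\<And>x. partial i \<phi> differentiable (at x)"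
    and dj: "\<And>x. partial j \<phi> differentiable (at x)"
    and cij: "continuous_on UNIV (partial j (partial i \<phi>))"
    and cji: "continuous_on UNIV (partial i (partial j \<phi>))"
  shows "partial j (partial i \<phi>) x = partial i (partial j \<phi>) x"
proof -
  let ?h = "\<lambda>n. inverse (real (Suc n))"
  have "\<exists>s t u w. (0 < s \<and> s < ?h n \<and> 0 < t \<and> t < ?h n \<and> 0 < u \<and> u < ?h n \<and> 0 < w \<and> w < ?h n) \<and>
      partial j (partial i \<phi>) (x + s *\<^sub>R axis i 1 + t *\<^sub>R axis j 1)
      = partial i (partial j \<phi>) (x + u *\<^sub>R axis j 1 + w *\<^sub>R axis i 1)" for n
  proof -
    have h: "0 < ?h n" by simp
    obtain s t where st: "0 < s" "s < ?h n" "0 < t" "t < ?h n"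
      "\<phi> (x + ?h n *\<^sub>R axis i 1 + ?h n *\<^sub>R axis j 1) - \<phi> (x + ?h n *\<^sub>R axis i 1) - \<phi> (x + ?h n *\<^sub>R axis j 1) + \<phi> x
          = ?h n * ?h n * partial j (partial i \<phi>) (x + s *\<^sub>R axis i 1 + t *\<^sub>R axis j 1)"
      by (rule second_difference[OF d di h])
    obtain u w where uw: "0 < u" "u < ?h n" "0 < w" "w < ?h n"
      "\<phi> (x + ?h n *\<^sub>R axis j 1 + ?h n *\<^sub>R axis i 1) - \<phi> (x + ?h n *\<^sub>R axis j 1) - \<phi> (x + ?h n *\<^sub>R axis i 1) + \<phi> x
          = ?h n * ?h n * partial i (partial j \<phi>) (x + u *\<^sub>R axis j 1 + w *\<^sub>R axis i 1)"
      by (rule second_difference[OF d dj h])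
    have "?h n * ?h n * partial j (partial i \<phi>) (x + s *\<^sub>R axis i 1 + t *\<^sub>R axis j 1)
        = ?h n * ?h n * partial i (partial j \<phi>) (x + u *\<^sub>R axis j 1 + w *\<^sub>R axis i 1)"
      unfolding st(5)[symmetric] uw(5)[symmetric] by (simp add: algebra_simps)
    then have "partial j (partial i \<phi>) (x + s *\<^sub>R axis i 1 + t *\<^sub>R axis j 1)
        = partial i (partial j \<phi>) (x + u *\<^sub>R axis j 1 + w *\<^sub>R axis i 1)"
      using h by (simp del: of_nat_Suc)
    then show ?thesis using st(1-4) uw(1-4) by blast
  qed
  then obtain s t u w where
    bounds: "\<And>n. 0 < s n \<and> s n < ?h n \<and> 0 < t n \<and> t n < ?h n \<and> 0 < u n \<and> u n < ?h n \<and> 0 < w n \<and> w n < ?h n"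
    and eq: "\<And>n. partial j (partial i \<phi>) (x + s n *\<^sub>R axis i 1 + t n *\<^sub>R axis j 1)
      = partial i (partial j \<phi>) (x + u n *\<^sub>R axis j 1 + w n *\<^sub>R axis i 1)"
    by metis
  have squeeze: "r \<longlonglongrightarrow> 0" if "\<And>n. 0 < r n \<and> r n < ?h n" for r
    by (rule tendsto_sandwich[OF _ _ tendsto_const LIMSEQ_inverse_real_of_nat])
      (use that in \<open>auto intro!: always_eventually less_imp_le\<close>)
  have lims: "s \<longlonglongrightarrow> 0" "t \<longlonglongrightarrow> 0" "u \<longlonglongrightarrow> 0" "w \<longlonglongrightarrow> 0"
    by (rule squeeze, use bounds in blast)+
  have "(\<lambda>n. x + s n *\<^sub>R axis i 1 + t n *\<^sub>R axis j 1) \<longlonglongrightarrow> x + 0 *\<^sub>R axis i 1 + 0 *\<^sub>R axis j 1"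
    by (intro tendsto_intros lims)
  moreover have "(\<lambda>n. x + u n *\<^sub>R axis j 1 + w n *\<^sub>R axis i 1) \<longlonglongrightarrow> x + 0 *\<^sub>R axis j 1 + 0 *\<^sub>R axis i 1"
    by (intro tendsto_intros lims)
  moreover have "isCont (partial j (partial i \<phi>)) x" "isCont (partial i (partial j \<phi>)) x"
    using cij cji by (auto simp: continuous_on_eq_continuous_at)
  ultimately have "(\<lambda>n. partial j (partial i \<phi>) (x + s n *\<^sub>R axis i 1 + t n *\<^sub>R axis j 1)) \<longlonglongrightarrow> partial j (partial i \<phi>) x"
    "(\<lambda>n. partial i (partial j \<phi>) (x + u n *\<^sub>R axis j 1 + w n *\<^sub>R axis i 1)) \<longlonglongrightarrow> partial i (partial j \<phi>) x"
    by (auto intro: isCont_tendsto_compose)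
  then show ?thesis using eq LIMSEQ_unique by (metis (no_types, lifting) ext)
qed

section \<open>Integrals over a period cell\<close>

lemma integral_cbox_split_coordinate:
  fixes G :: "real^'n \<Rightarrow> real"
  assumes "continuous_on UNIV G" "c $ j \<le> m" "m \<le> d $ j"
  shows "integral (cbox c d) G
     = integral (cbox c (\<chi> k. if k = j then m else d $ k)) G
     + integral (cbox (\<chi> k. if k = j then m else c $ k) d) G"
proof -
  let ?d = "\<chi> k. if k = j then m else d $ k" and ?c = "\<chi> k. if k = j then m else c $ k"
  have int: "G integrable_on cbox p q" for p q
    using assms(1) by (intro integrable_continuous) (rule continuous_on_subset, auto)
  have "cbox c d \<inter> {x. x \<bullet> axis j 1 \<le> m} = cbox c ?d"
    "cbox c d \<inter> {x. x \<bullet> axis j 1 \<ge> m} = cbox ?c d"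
    using assms(2,3)
    by (simp_all add: mem_box_cart inner_axis set_eq_iff) (smt (verit))+
  then have "(G has_integral (integral (cbox c ?d) G + integral (cbox ?c d) G)) (cbox c d)"
    using int by (intro has_integral_split[where k = "axis j 1" and c = m])
       (auto simp: Basis_vec_def)
  then show ?thesis by (rule integral_unique)
qed

text \<open>What a cell moved in direction \<open>j\<close> gains on its far side is the slab that it loses on its near
  side, translated by one period.\<close>

lemma integral_period_cell_translate:
  fixes G :: "real^'n \<Rightarrow> real"
  assumes cont: "continuous_on UNIV G" and per: "\<And>x. G (x + axis j (L $ j)) = G x"
    and t: "0 \<le> t" "t \<le> L $ j"
  shows "integral (cbox (a + axis j t) (a + L + axis j t)) G = integral (cbox a (a + L)) G"
proof -
  let ?T = "axis j t" and ?P = "axis j (L $ j)"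
  have "integral (cbox (a + ?T) (a + L + ?T)) G
      = integral (cbox (a + ?T) (a + L)) G + integral (cbox (a + ?P) (a + L + ?T)) G"
  proof -
    have "(\<chi> k. if k = j then a $ j + L $ j else (a + L + ?T) $ k) = a + L"
      "(\<chi> k. if k = j then a $ j + L $ j else (a + ?T) $ k) = a + ?P"
      by (auto simp: vec_eq_iff axis_def)
    then show ?thesis
      using integral_cbox_split_coordinate[OF cont, of "a + ?T" j "a $ j + L $ j" "a + L + ?T"] t
      by simp
  qed
  also have "integral (cbox (a + ?P) (a + L + ?T)) G = integral (cbox a (a + L + ?T - ?P)) G"
    using integral_shift_cbox[of "a + ?P" ?P "a + L + ?T" G] per by simp
  also have "integral (cbox (a + ?T) (a + L)) G + integral (cbox a (a + L + ?T - ?P)) G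
      = integral (cbox a (a + L)) G"
  proof -
    have "(\<chi> k. if k = j then a $ j + t else (a + L) $ k) = a + L + ?T - ?P"
      "(\<chi> k. if k = j then a $ j + t else a $ k) = a + ?T"
      by (auto simp: vec_eq_iff axis_def)
    then show ?thesis
      using integral_cbox_split_coordinate[OF cont, of a j "a $ j + t" "a + L"] t by simp
  qed
  finally show ?thesis .
qed

text \<open>The integral of \<open>x \<mapsto> f (x + t e_j)\<close> over the cell is independent of \<open>t\<close> by periodicity, and its
  derivative at \<open>t = 0\<close> under the integral sign is the integral in question. Restricting \<open>t\<close> to
  one period \<open>[0, L_j]\<close> makes this a one-sided derivative, which is still unique.\<close>

lemma integral_partial_period_cell:
  fixes f :: "real^'n \<Rightarrow> real"
  assumes diff: "\<And>x. f differentiable (at x)" and cont: "continuous_on UNIV (partial j f)"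
    and per: "periodic_with L f"
  shows "integral (cbox a (a + L)) (partial j f) = 0"
proof -
  let ?I = "\<lambda>t. integral (cbox a (a + L)) (\<lambda>x. f (x + t *\<^sub>R axis j 1))"
  have L: "0 < L $ j" and per': "\<And>x. f (x + axis j (L $ j)) = f x"
    using per by (auto simp: periodic_with_def)
  have fcont: "continuous_on UNIV f"
    using diff by (simp add: differentiable_imp_continuous_within continuous_on_eq_continuous_within)
  have "?I t = ?I 0" if "t \<in> {0..L $ j}" for t
    using integral_period_cell_translate[OF fcont, of j L t a] per' that
      integral_shift_cbox[of "a + axis j t" "axis j t" "a + L + axis j t" f]
    by (simp add: scaleR_axis axis_eq_0_iff[THEN iffD2, OF refl])
  then have "(?I has_vector_derivative 0) (at 0 within {0..L $ j})"
    using L by (intro has_vector_derivative_transform[OF _ _ has_vector_derivative_const[of "?I 0"]]) auto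
  moreover have "(?I has_vector_derivative integral (cbox a (a + L)) (\<lambda>x. partial j f (x + 0 *\<^sub>R axis j 1)))
      (at 0 within {0..L $ j})"
  proof (rule leibniz_rule_vector_derivative)
    show "((\<lambda>t. f (x + t *\<^sub>R axis j 1)) has_vector_derivative partial j f (x + t *\<^sub>R axis j 1))
        (at t within {0..L $ j})" for t x
      using has_real_derivative_along_axis[OF diff] by (simp add: has_real_derivative_iff_has_vector_derivative)
    show "(\<lambda>x. f (x + t *\<^sub>R axis j 1)) integrable_on cbox a (a + L)" for t
      by (intro integrable_continuous continuous_on_compose2[OF fcont]) (auto intro!: continuous_intros)
    show "continuous_on ({0..L $ j} \<times> cbox a (a + L)) (\<lambda>(t, x). partial j f (x + t *\<^sub>R axis j 1))"
      unfolding split_beta by (intro continuous_on_compose2[OF cont]) (auto intro!: continuous_intros)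
  qed (use L in auto)
  moreover have "at 0 within {0..L $ j} \<noteq> bot"
    using L by (simp add: at_within_Icc_at_right)
  ultimately show ?thesis
    using vector_derivative_unique_within by fastforce
qed

lemma Ck2D:
  assumes "Ck 2 f"
  shows "f differentiable (at x)" and "partial j f differentiable (at x)"
    and "continuous_on UNIV f" and "continuous_on UNIV (partial j f)"
    and "continuous_on UNIV (partial i (partial j f))"
  using assms[unfolded Ck_def, THEN conjunct1, rule_format, of "[]"]
    assms[unfolded Ck_def, THEN conjunct1, rule_format, of "[j]"]
    assms[unfolded Ck_def, THEN conjunct2, rule_format, of "[]"]
    assms[unfolded Ck_def, THEN conjunct2, rule_format, of "[j]"]
    assms[unfolded Ck_def, THEN conjunct2, rule_format, of "[i, j]"]
  by simp_all

text \<open>Energy argument: for harmonic \<open>p\<close> one has \<open>|\<nabla>p|\<^sup>2 = \<Sum>_j \<partial>_j (p \<partial>_j p)\<close>, whose integral over each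
  cell vanishes. A continuous nonnegative function with integral zero vanishes on the cell, and
  every point lies in the cell of which it is the corner.\<close>

lemma periodic_harmonic_constant:
  fixes p :: "real^'n \<Rightarrow> real"
  assumes C2: "Ck 2 p" and per: "spatially_periodic p" and harmonic: "\<And>x. laplacian p x = 0"
  shows "\<exists>c. \<forall>x. p x = c"
proof -
  obtain L where L: "periodic_with L p" using per by (auto simp: spatially_periodic_def)
  note dp = Ck2D(1)[OF C2] and dpj = Ck2D(2)[OF C2]
    and cp = Ck2D(3)[OF C2] and cpj = Ck2D(4)[OF C2] and cpjj = Ck2D(5)[OF C2]
  have zero: "integral (cbox a (a + L)) (partial j (\<lambda>x. p x * partial j p x)) = 0" for a j
  proof (rule integral_partial_period_cell)
    show "(\<lambda>x. p x * partial j p x) differentiable (at x)" for x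
      by (simp add: dp dpj)
    show "continuous_on UNIV (partial j (\<lambda>x. p x * partial j p x))"
      by (simp add: partial_mult[OF dp dpj, abs_def] cong: continuous_on_cong)
         (intro continuous_intros cp cpj cpjj)
    have "partial j p (x + axis k (L $ k)) = partial j p x" for x k
    proof -
      have "p (x + axis k (L $ k) + h *\<^sub>R axis j 1) = p (x + h *\<^sub>R axis j 1)" for h
        using L unfolding periodic_with_def by (metis add.assoc add.commute)
      then show ?thesis by (simp add: partial_def)
    qed
    then show "periodic_with L (\<lambda>x. p x * partial j p x)"
      using L by (simp add: periodic_with_def)
  qed
  have partial_zero: "partial j p a = 0" for a j
  proof -
    let ?E = "\<lambda>x. \<Sum>j\<in>UNIV. (partial j p x)\<^sup>2"
    have E: "?E x = (\<Sum>j\<in>UNIV. partial j (\<lambda>x. p x * partial j p x) x)" for x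
      using harmonic[of x] by (simp add: laplacian_def partial_mult[OF dp dpj] sum.distrib
          sum_distrib_left[symmetric] power2_eq_square)
    have cont: "continuous_on UNIV (partial j (\<lambda>x. p x * partial j p x))" for j
      by (simp add: partial_mult[OF dp dpj, abs_def] cong: continuous_on_cong)
         (intro continuous_intros cp cpj cpjj)
    have "integral (cbox a (a + L)) ?E = 0"
      unfolding E by (subst integral_sum)
        (auto simp: zero intro!: integrable_continuous continuous_on_subset[OF cont])
    moreover have "continuous_on (cbox a (a + L)) ?E"
      by (intro continuous_intros continuous_on_subset[OF cpj]) auto
    moreover have "box a (a + L) \<noteq> {}" "a \<in> cbox a (a + L)"
      using L by (auto simp: interval_ne_empty_cart periodic_with_def mem_box_cart less_imp_le)
    ultimately have "?E a = 0"
      by (subst (asm) integral_cbox_eq_0_iff) (auto intro: sum_nonneg)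
    then show ?thesis by (simp add: sum_nonneg_eq_0_iff)
  qed
  show ?thesis using constant_if_grad_zero[OF dp partial_zero] .
qed

section \<open>Convective term\<close>

text \<open>By the product rule \<open>\<partial>_i (v_j \<partial>_j v_i) = \<partial>_i v_j \<partial>_j v_i + v_j \<partial>_j \<partial>_i v_i\<close>; summed over \<open>i\<close>, the
  second term is the derivative of the divergence along \<open>v\<close>.\<close>

lemma divergence_advect_self:
  assumes C2: "\<And>i. Ck 2 (\<lambda>y. v y $ i)" and div0: "\<And>x. divergence v x = 0"
  shows "divergence (advect v v) x
     = (\<Sum>i\<in>UNIV. \<Sum>j\<in>UNIV. partial i (\<lambda>y. v y $ j) x * partial j (\<lambda>y. v y $ i) x)"
proof -
  let ?v = "\<lambda>i y. v y $ i"
  note d = Ck2D(1,2)[OF C2]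
  have comm: "partial i (partial j (?v i)) x = partial j (partial i (?v i)) x" for i j
    by (intro mixed_partials_commute Ck2D[OF C2])
  have div_grad: "(\<Sum>i\<in>UNIV. partial j (partial i (?v i)) x) = 0" for j
  proof -
    have "divergence v = (\<lambda>x. 0)" using div0 by auto
    then have "partial j (\<lambda>x. \<Sum>i\<in>UNIV. partial i (?v i) x) x = 0"
      by (simp add: divergence_def[abs_def])
    then show ?thesis by (simp add: partial_sum d)
  qed
  have "divergence (advect v v) x
      = (\<Sum>i\<in>UNIV. \<Sum>j\<in>UNIV. v x $ j * partial i (partial j (?v i)) x + partial i (?v j) x * partial j (?v i) x)"
    by (simp add: divergence_def advect_def partial_sum partial_mult d)
  also have "\<dots> = (\<Sum>j\<in>UNIV. v x $ j * (\<Sum>i\<in>UNIV. partial j (partial i (?v i)) x))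
      + (\<Sum>i\<in>UNIV. \<Sum>j\<in>UNIV. partial i (?v j) x * partial j (?v i) x)"
    unfolding sum.distrib sum_distrib_left
    by (subst sum.swap) (simp only: comm)
  also have "\<dots> = (\<Sum>i\<in>UNIV. \<Sum>j\<in>UNIV. partial i (?v j) x * partial j (?v i) x)"
    by (simp add: div_grad)
  finally show ?thesis .
qed

lemma tensor_divergence_outer_self:
  assumes d: "\<And>i x. (\<lambda>y. v y $ i) differentiable (at x)" and div0: "\<And>x. divergence v x = 0"
  shows "tensor_divergence (\<lambda>y. outer (v y) (v y)) x = advect v v x"
proof -
  have "tensor_divergence (\<lambda>y. outer (v y) (v y)) x $ i
      = v x $ i * divergence v x + advect v v x $ i" for i
    by (simp add: tensor_divergence_def outer_def advect_def divergence_def partial_mult d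
        sum.distrib sum_distrib_left mult.commute)
  then show ?thesis by (simp add: vec_eq_iff div0)
qed

text \<open>Where \<open>v\<close> vanishes the second derivatives drop out, so that the curl of the convective term can
  be read off from the Jacobian alone.\<close>

lemma partial_advect_self_at_stagnation_point:
  assumes C2: "\<And>i. Ck 2 (\<lambda>y. v y $ i)" and "v x = 0"
  shows "partial j (\<lambda>y. advect v v y $ i) x
     = (\<Sum>k\<in>UNIV. partial j (\<lambda>y. v y $ k) x * partial k (\<lambda>y. v y $ i) x)"
  using \<open>v x = 0\<close> by (simp add: advect_def partial_sum partial_mult Ck2D(1,2)[OF C2])

section \<open>Trigonometric polynomials\<close>

text \<open>This algebra of functions is closed under partial differentiation and consists of differentiable
  functions with common periods. Smoothness and periodicity of everything built from the velocity by
  sums, products and derivatives follow at once.\<close>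

inductive trig_poly :: "real \<Rightarrow> (real^'n::finite \<Rightarrow> real) \<Rightarrow> bool" for \<alpha> where
  const: "trig_poly \<alpha> (\<lambda>x. c)"
| sin: "trig_poly \<alpha> (\<lambda>x. sin (\<alpha> * x $ k + b))"
| add: "trig_poly \<alpha> f \<Longrightarrow> trig_poly \<alpha> g \<Longrightarrow> trig_poly \<alpha> (\<lambda>x. f x + g x)"
| mult: "trig_poly \<alpha> f \<Longrightarrow> trig_poly \<alpha> g \<Longrightarrow> trig_poly \<alpha> (\<lambda>x. f x * g x)"

lemma trig_poly_cos: "trig_poly \<alpha> (\<lambda>x. cos (\<alpha> * x $ k + b))"
  using trig_poly.sin[of \<alpha> k "b + pi / 2"] by (simp add: sin_add flip: add.assoc)

lemma trig_poly_sum: "(\<And>k. k \<in> K \<Longrightarrow> trig_poly \<alpha> (f k)) \<Longrightarrow> trig_poly \<alpha> (\<lambda>x. \<Sum>k\<in>K. f k x)"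
  by (induction K rule: infinite_finite_induct) (auto intro: trig_poly.intros)

lemma trig_poly_prod: "(\<And>k. k \<in> K \<Longrightarrow> trig_poly \<alpha> (f k)) \<Longrightarrow> trig_poly \<alpha> (\<lambda>x. \<Prod>k\<in>K. f k x)"
  by (induction K rule: infinite_finite_induct) (auto intro: trig_poly.intros)

lemma has_derivative_sin_coordinate:
  fixes \<alpha> b :: real
  shows "((\<lambda>x. sin (\<alpha> * x $ k + b)) has_derivative (\<lambda>h. \<alpha> * h $ k * cos (\<alpha> * x $ k + b))) (at x)"
  by (auto intro!: derivative_eq_intros bounded_linear.has_derivative[OF bounded_linear_vec_nth])

lemma trig_poly_differentiable: "trig_poly \<alpha> f \<Longrightarrow> f differentiable (at x)"
proof (induction rule: trig_poly.induct)
  case (sin k b)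
  show ?case by (rule differentiableI[OF has_derivative_sin_coordinate])
qed auto

lemma partial_sin:
  "partial j (\<lambda>x. sin (\<alpha> * x $ k + b)) x = (if j = k then \<alpha> * cos (\<alpha> * x $ k + b) else 0)"
  using partial_eq_derivative[OF has_derivative_sin_coordinate, of j \<alpha> k b x] by (auto simp: axis_def)

lemma trig_poly_partial: "trig_poly \<alpha> f \<Longrightarrow> trig_poly \<alpha> (partial j f)"
proof (induction rule: trig_poly.induct)
  case (sin k b)
  have "trig_poly \<alpha> (\<lambda>x. \<alpha> * cos (\<alpha> * x $ k + b))"
    by (intro trig_poly.mult trig_poly.const trig_poly_cos)
  then show ?case
    by (cases "j = k") (simp_all add: partial_sin[abs_def] trig_poly.const)
next
  case (add f g)
  then have "partial j (\<lambda>x. f x + g x) = (\<lambda>x. partial j f x + partial j g x)"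
    by (simp add: partial_add trig_poly_differentiable fun_eq_iff)
  then show ?case using add.IH by (simp add: trig_poly.add)
next
  case (mult f g)
  then have "partial j (\<lambda>x. f x * g x) = (\<lambda>x. f x * partial j g x + partial j f x * g x)"
    by (simp add: partial_mult trig_poly_differentiable fun_eq_iff)
  then show ?case using mult by (simp add: trig_poly.intros)
qed (simp add: trig_poly.const)

lemma trig_poly_Ck:
  assumes "trig_poly \<alpha> f" shows "Ck k f"
proof -
  have "trig_poly \<alpha> (iter_partial js f)" for js
    by (induction js) (use assms in \<open>auto intro: trig_poly_partial\<close>)
  then have "iter_partial js f differentiable (at x)" for js x
    using trig_poly_differentiable by blast
  then show ?thesis
    by (simp add: Ck_def differentiable_imp_continuous_within continuous_on_eq_continuous_within)
qed

lemma trig_poly_periodic: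
  assumes "trig_poly \<alpha> f" "\<alpha> > 0"
  shows "periodic_with (vec (2 * pi / \<alpha>)) f"
proof -
  have "f (x + axis j (2 * pi / \<alpha>)) = f x" for x j
    using assms(1)
  proof (induction rule: trig_poly.induct)
    case (sin k b)
    have "\<alpha> * (x + axis j (2 * pi / \<alpha>)) $ k + b = (\<alpha> * x $ k + b) + (if j = k then 2 * pi else 0)"
      using \<open>\<alpha> > 0\<close> by (auto simp: axis_def field_simps)
    then show ?case by (simp only: sin_periodic add_0_right split: if_split) simp
  qed auto
  then show ?thesis using \<open>\<alpha> > 0\<close> by (simp add: periodic_with_def)
qed

section \<open>Products of sines and cosines\<close>

text \<open>Up to sign and scale, differentiation in direction \<open>j\<close> toggles the membership of \<open>j\<close> in \<open>T\<close>, so the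
  family is closed under all the derivatives needed. The common phase \<open>\<beta>\<close> leaves room
  for the shift by \<open>\<pi>/4\<close> that occurs in one of the two flows.\<close>

definition wave :: "real \<Rightarrow> real \<Rightarrow> 'n::finite set \<Rightarrow> real^'n \<Rightarrow> real" where
  "wave \<alpha> \<beta> T x = (\<Prod>k\<in>UNIV. if k \<in> T then cos (\<alpha> * x $ k + \<beta>) else sin (\<alpha> * x $ k + \<beta>))"

lemma trig_poly_wave: "trig_poly \<alpha> (wave \<alpha> \<beta> T)"
proof -
  have "trig_poly \<alpha> (\<lambda>x. if k \<in> T then cos (\<alpha> * x $ k + \<beta>) else sin (\<alpha> * x $ k + \<beta>))" for k
    by (cases "k \<in> T") (simp_all add: trig_poly_cos trig_poly.sin)
  then show ?thesis unfolding wave_def[abs_def] by (rule trig_poly_prod)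
qed

text \<open>Only the factor of coordinate \<open>j\<close> depends on the step; its sine and cosine are exchanged.\<close>

lemma partial_wave:
  "partial j (wave \<alpha> \<beta> T) x
     = \<alpha> * (if j \<in> T then - wave \<alpha> \<beta> (T - {j}) x else wave \<alpha> \<beta> (insert j T) x)"
proof -
  define F where "F k S t = (if k \<in> S then cos (\<alpha> * t + \<beta>) else sin (\<alpha> * t + \<beta>))" for k :: 'a and S t
  define R where "R = (\<Prod>k\<in>UNIV - {j}. F k T (x $ k))"
  have wave_F: "wave \<alpha> \<beta> S y = F j S (y $ j) * (\<Prod>k\<in>UNIV - {j}. F k S (y $ k))" for S y
    unfolding wave_def F_def by (subst prod.remove[of _ j]) auto
  have R: "wave \<alpha> \<beta> S x = F j S (x $ j) * R" if "S - {j} = T - {j}" for S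
    unfolding wave_F R_def using that by (intro arg_cong2[where f = "(*)"] prod.cong) (auto simp: F_def)
  have "wave \<alpha> \<beta> T (x + h *\<^sub>R axis j 1) = F j T (x $ j + h) * R" for h
    unfolding wave_F R_def by (simp add: axis_def)
  then have "partial j (wave \<alpha> \<beta> T) x = deriv (\<lambda>h. F j T (x $ j + h) * R) 0"
    by (simp add: partial_def)
  also have "\<dots> = \<alpha> * (if j \<in> T then - sin (\<alpha> * x $ j + \<beta>) else cos (\<alpha> * x $ j + \<beta>)) * R"
    unfolding F_def by (rule DERIV_imp_deriv) (auto intro!: derivative_eq_intros)
  finally show ?thesis by (simp add: R F_def)
qed

text \<open>Toggling a position twice restores the set, at the price of one sign.\<close>

lemma laplacian_wave:
  "laplacian (wave \<alpha> \<beta> T) x = - (of_nat CARD('n) * \<alpha>\<^sup>2) * wave \<alpha> \<beta> T (x :: real^'n)"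
proof -
  have "partial j (partial j (wave \<alpha> \<beta> T)) x = - \<alpha>\<^sup>2 * wave \<alpha> \<beta> T x" for j
    by (cases "j \<in> T") (simp_all add: partial_wave[abs_def] partial_cmult
        trig_poly_differentiable[OF trig_poly_wave] partial_cmult[where c = "-1", simplified] power2_eq_square insert_absorb)
  then show ?thesis by (simp add: laplacian_def)
qed

text \<open>Coordinate by coordinate, both sides have the same pair of factors.\<close>

lemma wave_mult:
  "wave \<alpha> \<beta> S x * wave \<alpha> \<beta> T x = wave \<alpha> \<beta> (S \<inter> T) x * wave \<alpha> \<beta> (S \<union> T) x"
  unfolding wave_def prod.distrib[symmetric] by (rule prod.cong) auto

text \<open>At this point every angle \<open>\<alpha> x_k + \<beta>\<close> is \<open>0\<close> or \<open>\<pi>/2\<close>, and \<open>S\<close> is the set of coordinates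
  where the cosine is 1 and the sine 0.\<close>

definition node :: "real \<Rightarrow> real \<Rightarrow> 'n::finite set \<Rightarrow> real^'n" where
  "node \<alpha> \<beta> S = (\<chi> k. ((if k \<in> S then 0 else pi / 2) - \<beta>) / \<alpha>)"

text \<open>At a node exactly one wave is nonzero, so nodes separate the waves.\<close>

lemma wave_node:
  assumes "\<alpha> \<noteq> 0" shows "wave \<alpha> \<beta> T (node \<alpha> \<beta> S) = (if T = S then 1 else 0)"
proof -
  have "wave \<alpha> \<beta> T (node \<alpha> \<beta> S) = (\<Prod>k\<in>UNIV. if k \<in> T \<longleftrightarrow> k \<in> S then 1 else 0)"
    unfolding wave_def node_def by (rule prod.cong) (use assms in auto)
  also have "\<dots> = (if T = S then 1 else 0)"
    by (auto simp: set_eq_iff split: if_splits)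
  finally show ?thesis .
qed

section \<open>The cyclic field over the integers modulo 5\<close>

lemma UNIV_5: "UNIV = {0, 1, 2, 3, 4::5}"
  by (rule card_subset_eq[symmetric]) simp_all

lemma sum_5: "(\<Sum>k\<in>UNIV. f k) = f 0 + f 1 + f 2 + f 3 + f (4::5)"
  unfolding UNIV_5 by (simp add: ac_simps)

lemma prod_5: "(\<Prod>k\<in>UNIV. f k) = f 0 * f 1 * f 2 * f 3 * f (4::5)"
  unfolding UNIV_5 by (simp add: ac_simps)

lemma forall_5: "(\<forall>k::5. P k) \<longleftrightarrow> P 0 \<and> P 1 \<and> P 2 \<and> P 3 \<and> P 4"
  using UNIV_5 by (metis UNIV_I empty_iff insert_iff)

text \<open>The type \<open>5\<close> is the ring of integers modulo 5. The step \<open>\<sigma>\<close> is \<open>1\<close> or \<open>-1\<close>, the two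
  orientations of the cycle; \<open>\<sigma> \<sigma> = 1\<close> makes \<open>k \<mapsto> i + \<sigma> k\<close> a bijection with an explicit inverse.\<close>

locale cyclic_wave_field =
  fixes \<alpha> \<beta> A :: real and \<sigma> :: 5
  assumes alpha_pos: "\<alpha> > 0" and amplitude_nonzero: "A \<noteq> 0" and sigma_involutive: "\<sigma> * \<sigma> = 1"
begin

text \<open>Position sets are given relative to the index \<open>i\<close> and in steps of \<open>\<sigma>\<close>. This way all computations
  below involve only concrete subsets of \<open>\<int>/5\<close>, the same for both orientations.\<close>

definition W :: "5 \<Rightarrow> 5 set \<Rightarrow> real^5 \<Rightarrow> real" where
  "W i D = wave \<alpha> \<beta> ((\<lambda>k. i + \<sigma> * k) ` D)"

definition u :: "real^5 \<Rightarrow> real^5" where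
  "u x = (\<chi> i. A * (W i {3} x + W i {0, 2, 4} x))"

lemma index_inj: "i + \<sigma> * k = i + \<sigma> * m \<longleftrightarrow> k = m"
  by (metis add_left_cancel mult.assoc mult_1 sigma_involutive)

lemma inj_index: "inj_on (\<lambda>k. i + \<sigma> * k) S"
  by (rule inj_onI) (simp only: index_inj)

lemma index_surj: "\<exists>k. j = i + \<sigma> * k"
  by (rule exI[of _ "\<sigma> * (j - i)"]) (simp add: sigma_involutive flip: mult.assoc)

lemma sum_index: "(\<Sum>j\<in>UNIV. f j) = (\<Sum>k\<in>UNIV. f (i + \<sigma> * k))"
  by (rule sum.reindex_bij_betw[symmetric])
    (simp add: bij_def inj_index surj_def index_surj)

lemma sum_shift: "(\<Sum>i\<in>UNIV. f (i + \<sigma> * m)) = (\<Sum>i\<in>UNIV. f i)"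
  by (rule sum.reindex_bij_witness[of _ "\<lambda>i. i - \<sigma> * m" "\<lambda>i. i + \<sigma> * m"]) auto

text \<open>Moving the base index translates the relative positions; sums over all base indices therefore
  depend only on the position set up to translation.\<close>

lemma W_shift: "W (i + \<sigma> * m) D = W i ((\<lambda>k. m + k) ` D)"
  by (simp add: W_def image_image algebra_simps)

lemma W_mult: "W i D x * W i E x = W i (D \<inter> E) x * W i (D \<union> E) x"
  unfolding W_def image_Int[OF inj_index[of i UNIV]] image_Un by (rule wave_mult)

lemma W_prod:
  "W i D x = (\<Prod>k\<in>UNIV. if k \<in> D then cos (\<alpha> * x $ (i + \<sigma> * k) + \<beta>) else sin (\<alpha> * x $ (i + \<sigma> * k) + \<beta>))"
proof -
  have "bij (\<lambda>k. i + \<sigma> * k)"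
    by (simp add: bij_def inj_index surj_def index_surj)
  from prod.reindex_bij_betw[OF this] show ?thesis
    unfolding W_def wave_def
    by (subst prod.reindex_bij_betw[OF \<open>bij _\<close>, symmetric]) (simp add: inj_image_mem_iff[OF inj_index])
qed

lemma partial_W:
  "partial (i + \<sigma> * d) (W i D) x = \<alpha> * (if d \<in> D then - W i (D - {d}) x else W i (insert d D) x)"
  by (simp add: W_def partial_wave image_set_diff[OF inj_index[of i UNIV]] inj_image_mem_iff[OF inj_index])

lemma trig_poly_W: "trig_poly \<alpha> (W i D)"
  by (simp add: W_def trig_poly_wave)

lemma trig_poly_u: "trig_poly \<alpha> (\<lambda>x. u x $ i)"
  unfolding u_def by (simp add: trig_poly.intros trig_poly_W)

lemma partial_u:
  "partial (i + \<sigma> * d) (\<lambda>x. u x $ i) x =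
     A * (partial (i + \<sigma> * d) (W i {3}) x + partial (i + \<sigma> * d) (W i {0, 2, 4}) x)"
  unfolding u_def
  by (simp add: partial_cmult[where f = "\<lambda>x. f x + g x" for f g] partial_add trig_poly_differentiable[OF trig_poly_W])

text \<open>The rows of the Jacobian, again relative to \<open>i\<close>. Each entry combines two waves with position sets of
  even size.\<close>

lemma jacobian:
  "partial i (\<lambda>x. u x $ i) x = \<alpha> * A * (W i {0, 3} x - W i {2, 4} x)"
  "partial (i + \<sigma> * 1) (\<lambda>x. u x $ i) x = \<alpha> * A * (W i {1, 3} x + W i {0, 1, 2, 4} x)"
  "partial (i + \<sigma> * 2) (\<lambda>x. u x $ i) x = \<alpha> * A * (W i {2, 3} x - W i {0, 4} x)"
  "partial (i + \<sigma> * 3) (\<lambda>x. u x $ i) x = \<alpha> * A * (W i {0, 2, 3, 4} x - W i {} x)"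
  "partial (i + \<sigma> * 4) (\<lambda>x. u x $ i) x = \<alpha> * A * (W i {3, 4} x - W i {0, 2} x)"
proof -
  have J: "partial (i + \<sigma> * d) (\<lambda>x. u x $ i) x =
      \<alpha> * A * ((if d = 3 then - W i {} x else W i {d, 3} x)
        + (if d \<in> {0, 2, 4} then - W i ({0, 2, 4} - {d}) x else W i (insert d {0, 2, 4}) x))" for d
    by (auto simp: partial_u partial_W algebra_simps)
  have D: "{0, 2, 4} - {0} = {2, 4::5}" "{0, 2, 4} - {2} = {0, 4::5}" "{0, 2, 4} - {4} = {0, 2::5}"
    by auto
  have E: "insert 1 {0, 2, 4} = {0, 1, 2, 4::5}" "insert 3 {0, 2, 4} = {0, 2, 3, 4::5}" "{4, 3} = {3, 4::5}"
    by auto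
  show "partial i (\<lambda>x. u x $ i) x = \<alpha> * A * (W i {0, 3} x - W i {2, 4} x)"
    using J[of 0] by (simp add: D)
  show "partial (i + \<sigma> * 1) (\<lambda>x. u x $ i) x = \<alpha> * A * (W i {1, 3} x + W i {0, 1, 2, 4} x)"
    using J[of 1] by (simp add: E)
  show "partial (i + \<sigma> * 2) (\<lambda>x. u x $ i) x = \<alpha> * A * (W i {2, 3} x - W i {0, 4} x)"
    using J[of 2] by (simp add: D)
  show "partial (i + \<sigma> * 3) (\<lambda>x. u x $ i) x = \<alpha> * A * (W i {0, 2, 3, 4} x - W i {} x)"
    using J[of 3] by (simp add: E)
  show "partial (i + \<sigma> * 4) (\<lambda>x. u x $ i) x = \<alpha> * A * (W i {3, 4} x - W i {0, 2} x)"
    using J[of 4] by (simp add: D E)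
qed

text \<open>The two sets in the diagonal entry are translates: \<open>{0, 3} + 4 = {4, 2}\<close>.\<close>

lemma divergence_u: "divergence u x = 0"
proof -
  have "W (i + \<sigma> * 4) {0, 3} = W i {2, 4}" for i
    unfolding W_shift by (rule arg_cong[where f = "W i"]) (auto simp: set_eq_iff forall_5)
  then have "(\<Sum>i\<in>UNIV. W i {0, 3} x) = (\<Sum>i\<in>UNIV. W i {2, 4} x)"
    using sum_shift[of "\<lambda>i. W i {0, 3} x" 4] by simp
  then show ?thesis
    by (simp add: divergence_def jacobian sum_subtractf flip: sum_distrib_left)
qed

text \<open>With \<open>J i d\<close> the derivative of \<open>u_i\<close> in direction \<open>i + \<sigma> d\<close>, the trace pairs \<open>J i d\<close> with
  \<open>J (i + \<sigma> d) (-d)\<close>. The pairings for \<open>d\<close> and \<open>-d\<close> have equal sums over \<open>i\<close>, so only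
  \<open>d = 0, 1, 2\<close> remain, the last two with weight 2. Rewriting mixed products by intersection and
  union leaves terms that cancel by translation: for instance \<open>{0, 3}, {2, 4}\<close> becomes
  \<open>{}, {0, 2, 3, 4}\<close>, while \<open>{1, 3}, {0, 4}\<close> becomes \<open>{}, {0, 1, 3, 4}\<close>, a translate of the former.\<close>

lemma jacobian_square_trace:
  "(\<Sum>i\<in>UNIV. \<Sum>j\<in>UNIV. partial i (\<lambda>x. u x $ j) x * partial j (\<lambda>x. u x $ i) x) = 0"
proof -
  define J where "J i d = partial (i + \<sigma> * d) (\<lambda>x. u x $ i) x" for i d
  let ?S = "\<lambda>f. \<Sum>i\<in>UNIV. f i"
  have swap: "partial i (\<lambda>x. u x $ (i + \<sigma> * d)) x = J (i + \<sigma> * d) (- d)" for i d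
    by (simp add: J_def)
  have shift_J: "?S (\<lambda>i. J (i + \<sigma> * d) (- d) * J i d) = ?S (\<lambda>i. J (i + \<sigma> * - d) d * J i (- d))" for d
    using sum_shift[of "\<lambda>i. J (i + \<sigma> * d) (- d) * J i d" "- d"] by (simp add: mult.commute)
  have neg: "- 1 = (4::5)" "- 2 = (3::5)" "- 3 = (2::5)" "- 4 = (1::5)"
    by simp_all
  have "(\<Sum>i\<in>UNIV. \<Sum>j\<in>UNIV. partial i (\<lambda>x. u x $ j) x * partial j (\<lambda>x. u x $ i) x)
      = ?S (\<lambda>i. \<Sum>d\<in>UNIV. J (i + \<sigma> * d) (- d) * J i d)"
  proof (rule sum.cong[OF refl])
    fix i
    show "(\<Sum>j\<in>UNIV. partial i (\<lambda>x. u x $ j) x * partial j (\<lambda>x. u x $ i) x)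
        = (\<Sum>d\<in>UNIV. J (i + \<sigma> * d) (- d) * J i d)"
      by (subst sum_index[of _ i]) (simp only: swap, simp only: J_def)
  qed
  also have "\<dots> = (\<Sum>d\<in>UNIV. ?S (\<lambda>i. J (i + \<sigma> * d) (- d) * J i d))"
    by (rule sum.swap)
  also have "\<dots> = ?S (\<lambda>i. J i 0 * J i 0) + 2 * ?S (\<lambda>i. J (i + \<sigma> * 1) 4 * J i 1)
      + 2 * ?S (\<lambda>i. J (i + \<sigma> * 2) 3 * J i 2)"
    using shift_J[of 1] shift_J[of 2] unfolding sum_5[of "\<lambda>d. ?S (\<lambda>i. J (i + \<sigma> * d) (- d) * J i d)"] neg by simp
  also have "\<dots> = 0"
  proof -
    have translates: "W (i + \<sigma> * 1) {3, 4} = W i {0, 4}" "W (i + \<sigma> * 1) {0, 2} = W i {1, 3}"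
      "W (i + \<sigma> * 2) {0, 2, 3, 4} = W i {0, 1, 2, 4}" "W (i + \<sigma> * 2) {} = W i {}" for i
      unfolding W_shift by (rule arg_cong[where f = "W i"], simp add: set_eq_iff forall_5)+
    have product: "W i D x * W i E x = W i F x * W i G x"
      if "D \<inter> E = F" "D \<union> E = G" for i D E F G
      using W_mult[of i D x E] that by simp
    have products:
      "W i {0, 3} x * W i {2, 4} x = W i {} x * W i {0, 2, 3, 4} x"
      "W i {1, 3} x * W i {0, 4} x = W i {} x * W i {0, 1, 3, 4} x"
      "W i {0, 1, 2, 4} x * W i {1, 3} x = W i {1} x * W i UNIV x"
      "W i {2, 3} x * W i {0, 1, 2, 4} x = W i {2} x * W i UNIV x" for i
      by (rule product; simp add: set_eq_iff forall_5)+
    \<comment> \<open>Substituting \<open>products\<close> backwards makes each of these a plain expansion.\<close>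
    have d0: "J i 0 * J i 0 = (\<alpha> * A)\<^sup>2 * ((W i {0, 3} x)\<^sup>2 + (W i {2, 4} x)\<^sup>2
        - 2 * (W i {} x * W i {0, 2, 3, 4} x))" for i
      unfolding products[symmetric] J_def by (simp add: jacobian power2_eq_square algebra_simps)
    have d1: "J (i + \<sigma> * 1) 4 * J i 1 = (\<alpha> * A)\<^sup>2 * (W i {} x * W i {0, 1, 3, 4} x - (W i {1, 3} x)\<^sup>2
        + W i {0, 1, 2, 4} x * W i {0, 4} x - W i {1} x * W i UNIV x)" for i
      unfolding products[symmetric] J_def jacobian translates by (simp add: power2_eq_square algebra_simps)
    have d2: "J (i + \<sigma> * 2) 3 * J i 2 = (\<alpha> * A)\<^sup>2 * (W i {2} x * W i UNIV x - W i {} x * W i {2, 3} x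
        - W i {0, 1, 2, 4} x * W i {0, 4} x + W i {} x * W i {0, 4} x)" for i
      unfolding products[symmetric] J_def jacobian translates by (simp add: power2_eq_square algebra_simps)
    have orbit: "?S f = ?S g" if "\<And>i. f (i + \<sigma> * m) = g i" for f g :: "5 \<Rightarrow> real" and m
      using sum_shift[of f m] that by simp
    have orbits:
      "?S (\<lambda>i. (W i {0, 3} x)\<^sup>2) = ?S (\<lambda>i. (W i {1, 3} x)\<^sup>2)"
      "?S (\<lambda>i. (W i {2, 4} x)\<^sup>2) = ?S (\<lambda>i. (W i {1, 3} x)\<^sup>2)"
      "?S (\<lambda>i. W i {} x * W i {0, 2, 3, 4} x) = ?S (\<lambda>i. W i {} x * W i {0, 1, 3, 4} x)"
      "?S (\<lambda>i. W i {1} x * W i UNIV x) = ?S (\<lambda>i. W i {2} x * W i UNIV x)"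
      "?S (\<lambda>i. W i {} x * W i {2, 3} x) = ?S (\<lambda>i. W i {} x * W i {0, 4} x)"
    proof -
      have "W (i + \<sigma> * 3) {0, 3} = W i {1, 3}" "W (i + \<sigma> * 4) {2, 4} = W i {1, 3}"
        "W (i + \<sigma> * 1) {} = W i {}" "W (i + \<sigma> * 1) {0, 2, 3, 4} = W i {0, 1, 3, 4}"
        "W (i + \<sigma> * 1) {1} = W i {2}" "W (i + \<sigma> * 1) UNIV = W i UNIV"
        "W (i + \<sigma> * 2) {2, 3} = W i {0, 4}" for i
        unfolding W_shift UNIV_5 by (rule arg_cong[where f = "W i"], simp add: set_eq_iff forall_5)+
      note shifts = this translates(4)
      show "?S (\<lambda>i. (W i {0, 3} x)\<^sup>2) = ?S (\<lambda>i. (W i {1, 3} x)\<^sup>2)"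
        by (rule orbit[of _ 3]) (simp only: shifts)
      show "?S (\<lambda>i. (W i {2, 4} x)\<^sup>2) = ?S (\<lambda>i. (W i {1, 3} x)\<^sup>2)"
        by (rule orbit[of _ 4]) (simp only: shifts)
      show "?S (\<lambda>i. W i {} x * W i {0, 2, 3, 4} x) = ?S (\<lambda>i. W i {} x * W i {0, 1, 3, 4} x)"
        by (rule orbit[of _ 1]) (simp only: shifts)
      show "?S (\<lambda>i. W i {1} x * W i UNIV x) = ?S (\<lambda>i. W i {2} x * W i UNIV x)"
        by (rule orbit[of _ 1]) (simp only: shifts)
      show "?S (\<lambda>i. W i {} x * W i {2, 3} x) = ?S (\<lambda>i. W i {} x * W i {0, 4} x)"
        by (rule orbit[of _ 2]) (simp only: shifts)
    qed
    show ?thesis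
      unfolding d0 d1 d2 sum_distrib_left[symmetric] sum.distrib sum_subtractf orbits by (simp add: algebra_simps)
  qed
  finally show ?thesis .
qed

lemma divergence_advect_u: "divergence (advect u u) x = 0"
  by (simp add: divergence_advect_self trig_poly_Ck[OF trig_poly_u] divergence_u jacobian_square_trace)

lemma laplacian_u: "laplacian (\<lambda>y. u y $ i) x = - (5 * \<alpha>\<^sup>2) * u x $ i"
proof -
  have lin: "partial j (\<lambda>y. A * (f y + g y)) = (\<lambda>y. A * (partial j f y + partial j g y))"
    if "trig_poly \<alpha> f" "trig_poly \<alpha> g" for f g :: "real^5 \<Rightarrow> real" and j
    using that by (simp add: partial_cmult partial_add trig_poly_differentiable fun_eq_iff)
  have "partial j (partial j (\<lambda>y. u y $ i)) x
      = A * (partial j (partial j (W i {3})) x + partial j (partial j (W i {0, 2, 4})) x)" for j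
    unfolding u_def by (simp add: lin trig_poly_W trig_poly_partial)
  then have "laplacian (\<lambda>y. u y $ i) x = A * (laplacian (W i {3}) x + laplacian (W i {0, 2, 4}) x)"
    by (simp add: laplacian_def sum.distrib sum_distrib_left distrib_left)
  also have "\<dots> = - (5 * \<alpha>\<^sup>2) * u x $ i"
    unfolding W_def laplacian_wave by (simp add: u_def W_def algebra_simps)
  finally show ?thesis .
qed

lemma W_node: "W i D (node \<alpha> \<beta> ((\<lambda>k. i + \<sigma> * k) ` E)) = (if D = E then 1 else 0)"
  unfolding W_def using alpha_pos by (simp add: wave_node inj_image_eq_iff[OF inj_index])

text \<open>At the node where only the wave \<open>{3}\<close> survives, the component with index 0 has the value \<open>A\<close>.\<close>

lemma u_nonzero: "\<exists>x. u x \<noteq> 0"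
proof
  have "{0, 2, 4} \<noteq> {3::5}" by (simp add: set_eq_iff forall_5)
  then have "u (node \<alpha> \<beta> ((\<lambda>k. 0 + \<sigma> * k) ` {3})) $ 0 = A"
    unfolding u_def by (simp only: vec_lambda_beta W_node) simp
  then show "u (node \<alpha> \<beta> ((\<lambda>k. 0 + \<sigma> * k) ` {3})) \<noteq> 0"
    using amplitude_nonzero by auto
qed

text \<open>At the node of the adjacent positions \<open>{0, 1}\<close> all waves of odd size vanish, hence so does
  \<open>u\<close>, and the only entries of the Jacobian that survive are those in which the wave \<open>{0, 1}\<close> occurs.
  They give \<open>\<partial>_0 g_1 = \<partial>_0 u_3 \<partial>_3 u_1 = - (\<alpha>A)\<^sup>2\<close> and \<open>\<partial>_1 g_0 = 0\<close>, indices being counted in steps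
  of \<open>\<sigma>\<close>.\<close>

lemma curl_advect_u_nonzero:
  "\<exists>i j x. partial j (\<lambda>y. advect u u y $ i) x - partial i (\<lambda>y. advect u u y $ j) x \<noteq> 0"
proof (intro exI)
  define x where "x = node \<alpha> \<beta> ((\<lambda>k. 0 + \<sigma> * k) ` {0, 1})"
  let ?J = "\<lambda>k i. partial (\<sigma> * k) (\<lambda>y. u y $ (\<sigma> * i)) x"
  have W0: "W 0 D x = (if D = {0, 1} then 1 else 0)" for D
    unfolding x_def by (rule W_node)
  have W: "W (\<sigma> * i) D x = (if (\<lambda>k. i + k) ` D = {0, 1} then 1 else 0)" for i D
    using W_shift[of 0 i D] by (simp add: W0)
  note W1 = W[of 1, unfolded mult_1_right]
  have J: "?J (i + d) i = partial (\<sigma> * i + \<sigma> * d) (\<lambda>y. u y $ (\<sigma> * i)) x" for i d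
    by (simp add: distrib_left)
  have J0: "?J k 0 = 0" for k
  proof -
    have "\<forall>k. ?J (0 + k) 0 = 0"
      unfolding forall_5 J using jacobian[of "\<sigma> * 0" x] by (simp add: W0 set_eq_iff forall_5)
    then show ?thesis by simp
  qed
  have J1: "?J k 1 = (if k = 3 then - (\<alpha> * A) else 0)" for k
  proof -
    have "\<forall>d. ?J (1 + d) 1 = (if d = 2 then - (\<alpha> * A) else 0)"
      unfolding forall_5 J using jacobian[of "\<sigma> * 1" x]
      by (simp add: W1 set_eq_iff forall_5)
    from this[rule_format, of "k - 1"] show ?thesis by (simp add: diff_eq_eq)
  qed
  have J3: "?J 0 3 = \<alpha> * A"
  proof -
    have "?J (3 + 2) 3 = \<alpha> * A"
      unfolding J jacobian W by (simp add: set_eq_iff forall_5)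
    moreover have "3 + 2 = (0::5)" by simp
    ultimately show ?thesis by (simp only:)
  qed
  have stagnation: "u x = 0"
  proof -
    have "\<forall>k. u x $ (\<sigma> * k) = 0"
      unfolding forall_5 by (simp add: u_def W W0 W1 set_eq_iff forall_5)
    then show ?thesis using index_surj[of _ 0] by (metis add_0 vec_eq_iff zero_index)
  qed
  have expand: "partial (\<sigma> * j) (\<lambda>y. advect u u y $ (\<sigma> * i)) x = (\<Sum>k\<in>UNIV. ?J j k * ?J k i)" for i j
    using partial_advect_self_at_stagnation_point[OF trig_poly_Ck[OF trig_poly_u] stagnation]
      sum_index[of _ 0] by simp
  have "partial (\<sigma> * 0) (\<lambda>y. advect u u y $ (\<sigma> * 1)) x = - (\<alpha> * A)\<^sup>2"
    unfolding expand J1 using J3 by (simp add: sum_5 power2_eq_square)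
  moreover have "partial (\<sigma> * 1) (\<lambda>y. advect u u y $ (\<sigma> * 0)) x = 0"
    unfolding expand J0 by simp
  ultimately show "partial (\<sigma> * 0) (\<lambda>y. advect u u y $ (\<sigma> * 1)) x
      - partial (\<sigma> * 1) (\<lambda>y. advect u u y $ (\<sigma> * 0)) x \<noteq> 0"
    using alpha_pos amplitude_nonzero by simp
qed

end

section \<open>Forcing and exact solution\<close>

lemma trig_poly_smooth_field: "(\<And>i. trig_poly \<alpha> (\<lambda>x. w x $ i)) \<Longrightarrow> smooth_field w"
  by (auto simp: smooth_field_def smooth_fun_def intro: trig_poly_Ck)

lemma trig_poly_advect_self:
  "(\<And>i. trig_poly \<alpha> (\<lambda>x. v x $ i)) \<Longrightarrow> trig_poly \<alpha> (\<lambda>x. advect v v x $ i)"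
  by (simp add: advect_def trig_poly_sum trig_poly.mult trig_poly_partial)

lemma periodic_with_componentwise:
  assumes "\<And>i. periodic_with L (\<lambda>x. w x $ i)" shows "periodic_with L w"
  using assms by (simp add: periodic_with_def vec_eq_iff)

lemma continuous_trig_poly_field:
  fixes w :: "real^'n \<Rightarrow> real^'n"
  assumes "\<And>i. trig_poly \<alpha> (\<lambda>x. w x $ i)" shows "continuous_on S w"
proof -
  have "continuous_on S (\<lambda>x. w x $ i)" for i
    by (intro continuous_at_imp_continuous_on ballI differentiable_imp_continuous_within
        trig_poly_differentiable[OF assms])
  then have "continuous_on S (\<lambda>x. \<chi> i. w x $ i)" by (rule continuous_on_vec_lambda)
  then show ?thesis by simp
qed

text \<open>The convective term of a solenoidal field is a sum of partial derivatives of the periodic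
  functions \<open>v_i v_j\<close>.\<close>

lemma integral_advect_self_period_cell:
  fixes v :: "real^'n \<Rightarrow> real^'n"
  assumes trig: "\<And>i. trig_poly \<alpha> (\<lambda>x. v x $ i)" and "\<alpha> > 0" and div0: "\<And>x. divergence v x = 0"
  shows "integral (cbox a (a + vec (2 * pi / \<alpha>))) (advect v v) = 0"
proof -
  let ?C = "cbox a (a + vec (2 * pi / \<alpha>))"
  let ?T = "\<lambda>i j x. v x $ i * v x $ j"
  have T: "trig_poly \<alpha> (?T i j)" for i j
    by (intro trig_poly.mult trig)
  have "advect v v x $ i = (\<Sum>j\<in>UNIV. partial j (?T i j) x)" for x i
    using tensor_divergence_outer_self[OF trig_poly_differentiable[OF trig] div0, of x]
    by (simp add: tensor_divergence_def outer_def vec_eq_iff)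
  moreover have cont: "continuous_on S (partial j (?T i j))" for i j S
    by (intro continuous_at_imp_continuous_on ballI differentiable_imp_continuous_within
        trig_poly_differentiable[OF trig_poly_partial[OF T]])
  moreover have "integral ?C (partial j (?T i j)) = 0" for i j
    by (intro integral_partial_period_cell trig_poly_differentiable[OF T] cont
        trig_poly_periodic[OF T \<open>\<alpha> > 0\<close>])
  ultimately have "integral ?C (\<lambda>x. advect v v x $ i) = 0" for i
    by (simp add: integral_sum integrable_continuous)
  moreover have "advect v v integrable_on ?C"
    by (rule integrable_continuous[OF continuous_trig_poly_field[OF trig_poly_advect_self[OF trig]]])
  ultimately show ?thesis by (simp add: vec_eq_iff)
qed

text \<open>A potential of \<open>w\<close> is twice continuously differentiable because its gradient \<open>w\<close> is \<open>C^1\<close>, so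
  its mixed second derivatives commute.\<close>

lemma not_gradient_if_curl_nonzero:
  fixes w :: "real^'n \<Rightarrow> real^'n"
  assumes w: "\<And>i. Ck 1 (\<lambda>y. w y $ i)"
    and curl: "partial j (\<lambda>y. w y $ i) x \<noteq> partial i (\<lambda>y. w y $ j) x"
  shows "\<nexists>\<phi>. (\<forall>x. \<phi> differentiable (at x)) \<and> (\<forall>x. w x = grad \<phi> x)"
proof clarify
  fix \<phi> assume d: "\<forall>x. \<phi> differentiable (at x)" and "\<forall>x. w x = grad \<phi> x"
  then have p: "partial k \<phi> = (\<lambda>y. w y $ k)" for k
    by (simp add: grad_def fun_eq_iff)
  have "(\<lambda>y. w y $ k) differentiable (at y)" for k y
    using w[of k, unfolded Ck_def, THEN conjunct1, rule_format, of "[]"] by simp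
  moreover have "continuous_on UNIV (partial l (\<lambda>y. w y $ k))" for k l
    using w[of k, unfolded Ck_def, THEN conjunct2, rule_format, of "[l]"] by simp
  ultimately have "partial j (partial i \<phi>) x = partial i (partial j \<phi>) x"
    using d by (intro mixed_partials_commute) (simp_all add: p)
  then show False using curl by (simp add: p)
qed

lemma divergence_scaleR:
  "(\<And>i x. (\<lambda>y. w y $ i) differentiable (at x)) \<Longrightarrow> divergence (\<lambda>y. c *\<^sub>R w y) x = c * divergence w x"
  by (simp add: divergence_def partial_cmult sum_distrib_left)

lemma advect_scaleR:
  assumes "\<And>i x. (\<lambda>y. w y $ i) differentiable (at x)"
  shows "advect (\<lambda>y. c *\<^sub>R w y) (\<lambda>y. c *\<^sub>R w y) x = c\<^sup>2 *\<^sub>R advect w w x"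
  using assms by (simp add: advect_def partial_cmult vec_eq_iff sum_distrib_left power2_eq_square ac_simps)

text \<open>Diffusion acts on an eigenfield of the Laplacian as multiplication by \<open>-\<mu>\<kappa>\<close>, which is what the
  time derivative produces; the convective term is quadratic and decays at twice the rate, and it is
  balanced by the force.\<close>

lemma navier_stokes_decaying_eigenfield:
  fixes u :: "real^'n \<Rightarrow> real^'n"
  assumes trig: "\<And>i. trig_poly \<alpha> (\<lambda>x. u x $ i)"
    and div0: "\<And>x. divergence u x = 0"
    and eigen: "\<And>i x. laplacian (\<lambda>y. u y $ i) x = - \<mu> * u x $ i"
    and p: "\<And>x t. t \<ge> 0 \<Longrightarrow> p x t = q t"
  shows "navier_stokes_solution \<rho> \<kappa> (\<lambda>x t. exp (- \<mu> * \<kappa> * t) *\<^sub>R u x) p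
           (\<lambda>x t. exp (- 2 * \<mu> * \<kappa> * t) *\<^sub>R advect u u x)"
proof -
  let ?e = "\<lambda>t. exp (- \<mu> * \<kappa> * t)"
  note d = trig_poly_differentiable[OF trig] and d' = trig_poly_differentiable[OF trig_poly_partial[OF trig]]
  have pfun: "(\<lambda>y. p y t) = (\<lambda>y. q t)" if "t \<ge> 0" for t
    using p that by auto
  have time: "((\<lambda>s. ?e s *\<^sub>R u x) has_vector_derivative (- \<mu> * \<kappa> * ?e t) *\<^sub>R u x) (at t within {0..})" for x t
    by (auto intro!: derivative_eq_intros simp: has_vector_derivative_def fun_eq_iff)
  \<comment> \<open>This makes the time derivative unique, also the one-sided one at \<open>t = 0\<close>.\<close>
  have bot: "at t within {0..} \<noteq> bot" if "t \<ge> 0" for t :: real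
  proof -
    have "{0..} \<noteq> {s}" for s :: real
      by (metis add_increasing atLeast_iff insert_iff le_add_same_cancel1 less_add_one less_irrefl
          order_refl singletonD zero_le_one)
    then show ?thesis
      using connected_imp_perfect[of "{0::real..}" t] that by (simp add: trivial_limit_within)
  qed
  show ?thesis
    unfolding navier_stokes_solution_def
  proof (intro conjI allI impI)
    have "continuous_on (UNIV \<times> {0..}) (\<lambda>z. u (fst z))"
      by (rule continuous_on_compose2[OF continuous_trig_poly_field[OF trig, of UNIV]])
        (auto intro: continuous_intros)
    then show "continuous_on (UNIV \<times> {0..}) (\<lambda>(x, t). ?e t *\<^sub>R u x)"
      unfolding split_beta by (intro continuous_intros)
    show "Ck 2 (\<lambda>y. (?e t *\<^sub>R u y) $ i)" for t i
      by (simp add: trig_poly_Ck[of \<alpha>] trig_poly.intros trig)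
    show "Ck 1 (\<lambda>y. p y t)" if "0 \<le> t" for t
      unfolding pfun[OF that] by (rule trig_poly_Ck[OF trig_poly.const])
    show "(\<lambda>s. ?e s *\<^sub>R u x) differentiable (at t within {0..})" for x t
      using time by (blast intro: differentiableI_vector)
    show "divergence (\<lambda>y. ?e t *\<^sub>R u y) x = 0" for x t
      by (simp add: divergence_scaleR d div0)
    fix x :: "real^'n" and t :: real and i assume t: "0 \<le> t"
    have "vector_derivative (\<lambda>s. ?e s *\<^sub>R u x) (at t within {0..}) = (- \<mu> * \<kappa> * ?e t) *\<^sub>R u x"
      by (rule vector_derivative_within[OF bot[OF t] time])
    moreover have "(\<Sum>j\<in>UNIV. (?e t *\<^sub>R u x) $ j * partial j (\<lambda>y. (?e t *\<^sub>R u y) $ i) x)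
        = (?e t)\<^sup>2 * advect u u x $ i"
      using advect_scaleR[OF d, of "?e t" x] by (simp add: advect_def vec_eq_iff)
    moreover have "(?e t)\<^sup>2 = exp (- 2 * \<mu> * \<kappa> * t)"
      by (simp add: power2_eq_square flip: exp_add)
    moreover have "laplacian (\<lambda>y. (?e t *\<^sub>R u y) $ i) x = ?e t * laplacian (\<lambda>y. u y $ i) x"
    proof -
      have "partial j (\<lambda>y. (?e t *\<^sub>R u y) $ i) = (\<lambda>y. ?e t * partial j (\<lambda>y. u y $ i) y)" for j
        by (simp add: partial_cmult d fun_eq_iff)
      then show ?thesis by (simp add: laplacian_def partial_cmult d' sum_distrib_left)
    qed
    ultimately show "vector_derivative (\<lambda>s. ?e s *\<^sub>R u x) (at t within {0..}) $ i
          + (\<Sum>j\<in>UNIV. (?e t *\<^sub>R u x) $ j * partial j (\<lambda>y. (?e t *\<^sub>R u y) $ i) x)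
        = \<kappa> * laplacian (\<lambda>y. (?e t *\<^sub>R u y) $ i) x
          - (1 / \<rho>) * partial i (\<lambda>y. p y t) x + (exp (- 2 * \<mu> * \<kappa> * t) *\<^sub>R advect u u x) $ i"
      by (simp add: pfun[OF t] eigen)
  qed
qed

section \<open>The two phase vectors\<close>

lemma vector_5:
  "(vector [a, b, c, d, e] :: real^5) $ 1 = a" "(vector [a, b, c, d, e] :: real^5) $ 2 = b"
  "(vector [a, b, c, d, e] :: real^5) $ 3 = c" "(vector [a, b, c, d, e] :: real^5) $ 4 = d"
  "(vector [a, b, c, d, e] :: real^5) $ 5 = e"
  by (simp_all add: vector_def)

text \<open>Every phase is a multiple of \<open>\<pi>/2\<close> and so only permutes sines, cosines and signs.\<close>

lemma quintuple_field_xi_star_star: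
  assumes "\<alpha> > 0" "a > 0"
  shows "cyclic_wave_field \<alpha> a 1"
    and "quintuple_field \<alpha> a xi_star_star = cyclic_wave_field.u \<alpha> 0 a 1"
proof -
  show "cyclic_wave_field \<alpha> a 1" using assms by unfold_locales auto
  then interpret cyclic_wave_field \<alpha> 0 a 1 .
  show "quintuple_field \<alpha> a xi_star_star = u"
    by (simp add: fun_eq_iff vec_eq_iff quintuple_field_def field1_def xi_star_star_def vector_5
        u_def W_prod prod_5 sin_add cos_add algebra_simps)
qed

text \<open>Since \<open>sin (t - \<pi>/4) = - cos (t + \<pi>/4)\<close> and \<open>cos (t - \<pi>/4) = sin (t + \<pi>/4)\<close>, the phase
  \<open>-\<pi>/4\<close> turns into the common phase \<open>\<pi>/4\<close> and sine and cosine are exchanged. The sign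
  picked up by the first product agrees with the minus sign of the second, hence the amplitude
  \<open>-a\<close>. The resulting pattern runs through the coordinates
  in reverse order.\<close>

lemma quintuple_field_xi_star:
  assumes "\<alpha> > 0" "a > 0"
  shows "cyclic_wave_field \<alpha> (- a) (- 1)"
    and "quintuple_field \<alpha> a xi_star = cyclic_wave_field.u \<alpha> (pi / 4) (- a) (- 1)"
proof -
  show "cyclic_wave_field \<alpha> (- a) (- 1)" using assms by unfold_locales auto
  then interpret cyclic_wave_field \<alpha> "pi / 4" "- a" "- 1" .
  have quarter: "sin (t - pi / 4) = - cos (t + pi / 4)" "cos (t - pi / 4) = sin (t + pi / 4)" for t
    by (simp_all add: sin_add cos_add sin_diff cos_diff sin_45 cos_45)
  have neg: "i - 1 = i + 4" "i - 2 = i + 3" "i - 3 = i + 2" "i - 4 = i + (1::5)" for i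
    by (simp_all add: diff_eq_eq add.assoc)
  have mod5: "5 = (0::5)" "6 = (1::5)" "7 = (2::5)" "8 = (3::5)" "9 = (4::5)"
    by simp_all
  show "quintuple_field \<alpha> a xi_star = u"
    by (simp add: fun_eq_iff vec_eq_iff quintuple_field_def field1_def xi_star_def vector_5
        u_def W_prod prod_5 quarter neg) (simp add: algebra_simps mod5)
qed

theorem proposition5p2:
  fixes \<alpha> v\<^sub>r \<rho> \<kappa> :: real
    and \<xi> L :: "real^5"
    and v0 g0 f0 :: "real^5 \<Rightarrow> real^5"
    and v f :: "real^5 \<Rightarrow> real \<Rightarrow> real^5"
  assumes "\<alpha> > 0" and "v\<^sub>r > 0" and "\<rho> > 0" and "\<kappa> > 0"
    and "\<xi> = xi_star \<or> \<xi> = xi_star_star"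
    and "v0 = quintuple_field \<alpha> v\<^sub>r \<xi>"
    and "g0 = advect v0 v0"
    and "f0 = g0"
    and "L = vec (2 * pi / \<alpha>)"
    and "v = (\<lambda>x t. exp (- 5 * \<alpha>\<^sup>2 * \<kappa> * t) *\<^sub>R v0 x)"
    and "f = (\<lambda>x t. exp (- 10 * \<alpha>\<^sup>2 * \<kappa> * t) *\<^sub>R f0 x)"
  shows
    \<comment> \<open>(i)\<close>
    "((\<exists>x. v0 x \<noteq> 0) \<and> (\<forall>x. divergence v0 x = 0)) \<and>
     \<comment> \<open>(ii)\<close>
     ((\<forall>x. divergence g0 x = 0) \<and>
      (\<exists>\<phi> h. helmholtz_decomposition L g0 \<phi> h) \<and>
      (\<forall>\<phi> h. helmholtz_decomposition L g0 \<phi> h \<longrightarrow> (\<forall>x. grad \<phi> x = 0) \<and> h = g0)) \<and>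
     \<comment> \<open>(iii)\<close>
     ((\<nexists>\<phi>. (\<forall>x. \<phi> differentiable (at x)) \<and> (\<forall>x. g0 x = grad \<phi> x)) \<and>
      (\<exists>i j. \<exists>x. partial j (\<lambda>y. g0 y $ i) x - partial i (\<lambda>y. g0 y $ j) x \<noteq> 0)) \<and>
     \<comment> \<open>(iv): the Poisson equation for the amplitude, and for the pressure belonging to \<open>v\<close>\<close>
     ((\<forall>p. Ck 2 p \<and> spatially_periodic p \<and> (\<forall>x. laplacian p x = - \<rho> * divergence g0 x)
         \<longrightarrow> (\<exists>c. \<forall>x. p x = c)) \<and>
      (\<forall>p. (\<forall>t\<ge>0. Ck 2 (\<lambda>y. p y t) \<and> spatially_periodic (\<lambda>y. p y t) \<and>
               (\<forall>x. laplacian (\<lambda>y. p y t) x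
                    = - \<rho> * divergence (advect (\<lambda>y. v y t) (\<lambda>y. v y t)) x))
         \<longrightarrow> (\<exists>q :: real \<Rightarrow> real. \<forall>x. \<forall>t\<ge>0. p x t = q t))) \<and>
     \<comment> \<open>the body-force amplitude\<close>
     ((\<forall>x. f0 x = tensor_divergence (\<lambda>y. outer (v0 y) (v0 y)) x) \<and>
      periodic_with L f0 \<and>
      (\<forall>a. f0 integrable_on cbox a (a + L) \<and> cell_mean (cbox a (a + L)) f0 = 0)) \<and>
     \<comment> \<open>the exact solution\<close>
     (\<forall>p :: real^5 \<Rightarrow> real \<Rightarrow> real. (\<exists>q. \<forall>x. \<forall>t\<ge>0. p x t = q t) \<longrightarrow>
        (\<forall>x. \<forall>t\<ge>0. grad (\<lambda>y. p y t) x = 0) \<and>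
        navier_stokes_solution \<rho> \<kappa> v p f)"
proof -
  note alpha_pos = \<open>\<alpha> > 0\<close> and v0_def = \<open>v0 = quintuple_field \<alpha> v\<^sub>r \<xi>\<close> and g0_def = \<open>g0 = advect v0 v0\<close>
    and f0_def = \<open>f0 = g0\<close> and L_def = \<open>L = vec (2 * pi / \<alpha>)\<close>
  obtain \<beta> A \<sigma> where "cyclic_wave_field \<alpha> A \<sigma>" and v0_u: "v0 = cyclic_wave_field.u \<alpha> \<beta> A \<sigma>"
    using \<open>\<xi> = xi_star \<or> \<xi> = xi_star_star\<close> quintuple_field_xi_star[OF \<open>\<alpha> > 0\<close> \<open>v\<^sub>r > 0\<close>]
      quintuple_field_xi_star_star[OF \<open>\<alpha> > 0\<close> \<open>v\<^sub>r > 0\<close>] v0_def by metis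
  then interpret C: cyclic_wave_field \<alpha> \<beta> A \<sigma> by simp
  have trig_v0: "trig_poly \<alpha> (\<lambda>x. v0 x $ i)" for i
    unfolding v0_u by (rule C.trig_poly_u)
  have trig_g0: "trig_poly \<alpha> (\<lambda>x. g0 x $ i)" for i
    unfolding g0_def by (intro trig_poly_advect_self trig_v0)
  have div_v0: "divergence v0 x = 0" for x
    unfolding v0_u by (rule C.divergence_u)
  have div_g0: "divergence g0 x = 0" for x
    unfolding g0_def v0_u by (rule C.divergence_advect_u)
  have per_g0: "periodic_with L g0"
    unfolding L_def by (intro periodic_with_componentwise trig_poly_periodic[OF trig_g0 alpha_pos])
  have grad_const: "grad (\<lambda>y. c) x = 0" for c and x :: "real^5"
    by (simp add: grad_def vec_eq_iff)

  have i: "(\<exists>x. v0 x \<noteq> 0) \<and> (\<forall>x. divergence v0 x = 0)"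
    using C.u_nonzero div_v0 v0_u by simp

  have "helmholtz_decomposition L g0 (\<lambda>x. 0) g0"
    using per_g0 trig_poly_Ck[OF trig_poly.const]
    by (auto simp: helmholtz_decomposition_def div_g0 grad_const smooth_fun_def laplacian_def
        periodic_with_def intro: trig_poly_smooth_field[OF trig_g0])
  moreover have "(\<forall>x. grad \<phi> x = 0) \<and> h = g0" if "helmholtz_decomposition L g0 \<phi> h" for \<phi> h
  proof -
    have "\<exists>c. \<forall>x. \<phi> x = c"
      using that by (intro periodic_harmonic_constant)
        (auto simp: helmholtz_decomposition_def smooth_fun_def spatially_periodic_def div_g0)
    then obtain c where "\<phi> = (\<lambda>x. c)" by auto
    then show ?thesis
      using that by (auto simp: helmholtz_decomposition_def grad_const)
  qed
  ultimately have ii: "(\<forall>x. divergence g0 x = 0) \<and> (\<exists>\<phi> h. helmholtz_decomposition L g0 \<phi> h) \<and>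
      (\<forall>\<phi> h. helmholtz_decomposition L g0 \<phi> h \<longrightarrow> (\<forall>x. grad \<phi> x = 0) \<and> h = g0)"
    using div_g0 by blast

  obtain i j x where curl: "partial j (\<lambda>y. g0 y $ i) x - partial i (\<lambda>y. g0 y $ j) x \<noteq> 0"
    using C.curl_advect_u_nonzero unfolding g0_def v0_u by blast
  then have iii: "(\<nexists>\<phi>. (\<forall>x. \<phi> differentiable (at x)) \<and> (\<forall>x. g0 x = grad \<phi> x)) \<and>
      (\<exists>i j. \<exists>x. partial j (\<lambda>y. g0 y $ i) x - partial i (\<lambda>y. g0 y $ j) x \<noteq> 0)"
    using not_gradient_if_curl_nonzero[OF trig_poly_Ck[OF trig_g0], of j i x] by auto

  have div_advect_v: "divergence (advect (\<lambda>y. v y t) (\<lambda>y. v y t)) x = 0" for x t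
  proof -
    let ?e = "exp (- 5 * \<alpha>\<^sup>2 * \<kappa> * t)"
    have "advect (\<lambda>y. v y t) (\<lambda>y. v y t) = (\<lambda>y. ?e\<^sup>2 *\<^sub>R g0 y)"
      using advect_scaleR[OF trig_poly_differentiable[OF trig_v0], of ?e]
      by (simp add: \<open>v = _\<close> g0_def fun_eq_iff)
    then show ?thesis
      using divergence_scaleR[OF trig_poly_differentiable[OF trig_g0]] by (simp add: div_g0)
  qed
  have "\<exists>c. \<forall>x. p x = c"
    if "Ck 2 p" "spatially_periodic p" "\<forall>x. laplacian p x = - \<rho> * divergence g0 x" for p :: "real^5 \<Rightarrow> real"
    using that by (intro periodic_harmonic_constant) (auto simp: div_g0)
  moreover have "\<exists>q :: real \<Rightarrow> real. \<forall>x. \<forall>t\<ge>0. p x t = q t"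
    if "\<forall>t\<ge>0. Ck 2 (\<lambda>y. p y t) \<and> spatially_periodic (\<lambda>y. p y t) \<and>
          (\<forall>x. laplacian (\<lambda>y. p y t) x = - \<rho> * divergence (advect (\<lambda>y. v y t) (\<lambda>y. v y t)) x)"
    for p :: "real^5 \<Rightarrow> real \<Rightarrow> real"
  proof -
    have "\<forall>t\<ge>0. \<exists>c. \<forall>x. p x t = c"
      using that by (intro allI impI periodic_harmonic_constant) (auto simp: div_advect_v)
    then show ?thesis by metis
  qed
  ultimately have iv: "(\<forall>p. Ck 2 p \<and> spatially_periodic p \<and> (\<forall>x. laplacian p x = - \<rho> * divergence g0 x)
         \<longrightarrow> (\<exists>c. \<forall>x. p x = c)) \<and>
      (\<forall>p. (\<forall>t\<ge>0. Ck 2 (\<lambda>y. p y t) \<and> spatially_periodic (\<lambda>y. p y t) \<and>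
               (\<forall>x. laplacian (\<lambda>y. p y t) x
                    = - \<rho> * divergence (advect (\<lambda>y. v y t) (\<lambda>y. v y t)) x))
         \<longrightarrow> (\<exists>q :: real \<Rightarrow> real. \<forall>x. \<forall>t\<ge>0. p x t = q t))"
    by blast

  have "f0 x = tensor_divergence (\<lambda>y. outer (v0 y) (v0 y)) x" for x
    unfolding f0_def g0_def
    by (rule tensor_divergence_outer_self[OF trig_poly_differentiable[OF trig_v0] div_v0, symmetric])
  moreover have "f0 integrable_on cbox a (a + L)" for a
    unfolding f0_def by (rule integrable_continuous[OF continuous_trig_poly_field[OF trig_g0]])
  moreover have "cell_mean (cbox a (a + L)) f0 = 0" for a
    using integral_advect_self_period_cell[OF trig_v0 alpha_pos div_v0]
    by (simp add: cell_mean_def f0_def g0_def L_def)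
  ultimately have force: "(\<forall>x. f0 x = tensor_divergence (\<lambda>y. outer (v0 y) (v0 y)) x) \<and>
      periodic_with L f0 \<and>
      (\<forall>a. f0 integrable_on cbox a (a + L) \<and> cell_mean (cbox a (a + L)) f0 = 0)"
    using per_g0 f0_def by blast

  have "(\<forall>x. \<forall>t\<ge>0. grad (\<lambda>y. p y t) x = 0) \<and> navier_stokes_solution \<rho> \<kappa> v p f"
    if uniform: "\<exists>q. \<forall>x. \<forall>t\<ge>0. p x t = q t" for p :: "real^5 \<Rightarrow> real \<Rightarrow> real"
  proof -
    obtain q where q: "\<And>x t. t \<ge> 0 \<Longrightarrow> p x t = q t" using uniform by blast
    then have "grad (\<lambda>y. p y t) x = 0" if "t \<ge> 0" for x t
      using that by (simp add: grad_const)
    moreover have "navier_stokes_solution \<rho> \<kappa> (\<lambda>x t. exp (- (5 * \<alpha>\<^sup>2) * \<kappa> * t) *\<^sub>R v0 x) p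
        (\<lambda>x t. exp (- 2 * (5 * \<alpha>\<^sup>2) * \<kappa> * t) *\<^sub>R advect v0 v0 x)"
      by (rule navier_stokes_decaying_eigenfield[OF trig_v0 div_v0 _ q])
        (simp_all add: v0_u C.laplacian_u)
    ultimately show ?thesis by (simp add: \<open>v = _\<close> \<open>f = _\<close> f0_def g0_def)
  qed
  then show ?thesis using i ii iii iv force by blast
qed

end
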